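(* Let $(A,\varphi)$ be a noncommutative probability space over $B$ with $\varphi$ a $B$-trace, and let $a,a'\in A$ be $B$-even. If $a$ and $a'$ are free over $B$, then the pair $(aa',a'a)$ is ($B$-valued) R-diagonal.
   Context: A noncommutative probability space (NCPSpace) over $B$ is a pair $(A,\varphi)$, where $A$ is a unital complex algebra, $B\subset A$ is a subalgebra with $1_B=1_A$, and $\varphi:A\to B$ is linear with $\varphi(b)=b$ and $\varphi(bab')=b\varphi(a)b'$ for $b,b'\in B$, $a\in A$. It is a $B$-trace if $\varphi(aa')=\varphi(a'a)$ for all $a,a'\in A$. Freeness over $B$ of $a$ and $a'$ means freeness with amalgamation over $B$ of the subalgebras generated by $B\cup\{a\}$ and $B\cup\{a'\}$. An element $a\in A$ is $B$-even if $\varphi(ab_2a\cdots b_ma)=0_B$ for every odd $m$ and all $b_2,\dots,b_m\in B$. $NC(n)$ is the lattice of noncrossing partitions of $\{1,\dots,n\}$ ordered by refinement, with maximal element $1_n$ and Möbius function $\mu$. For $\pi\in NC(n)$, $\widehat\varphi(\pi)(a_1\otimes\cdots\otimes a_n)\in B$ is defined recursively. Put $\widehat\varphi(1_n)(a_1\otimes\cdots\otimes a_n)=\varphi(a_1\cdots a_n)$. If $\pi\ne1_n$, choose a block of $\pi$ that is an interval $\{l+1,\dots,l+s\}$, set $\beta=\varphi(a_{l+1}\cdots a_{l+s})$, remove the block, and replace $a_l$ by $a_l\beta$ (if $l=0$, replace $a_{s+1}$ by $\beta a_{s+1}$ instead). Then apply $\widehat\varphi$ of the remaining partition. The $B$-valued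 cumulants are $c^{(n)}(a_1\otimes\cdots\otimes a_n)=\sum_{\pi\in NC(n)}\widehat\varphi(\pi)(a_1\otimes\cdots\otimes a_n)\mu(\pi,1_n)$. $\Theta_B^s$ is the set of formal series $\sum_{n\ge1}\sum_{i_1,\dots,i_n\in\{1,\dots,s\}}b_{i_1,\dots,i_n}z_{i_1}\cdots z_{i_n}$ in noncommuting indeterminates with coefficients in $B$. The R-transform of $x_1,\dots,x_s\in A$ is $R_{x_1,\dots,x_s}(z_1,\dots,z_s)=\sum_{n\ge1}\sum_{i_1,\dots,i_n}k_n(x_{i_1},\dots,x_{i_n})z_{i_1}\cdots z_{i_n}$ with $k_n(x_{i_1},\dots,x_{i_n})=c^{(n)}(x_{i_1}\otimes b_{i_2}x_{i_2}\otimes\cdots\otimes b_{i_n}x_{i_n})$, where the inserted elements $b_{i_2},\dots,b_{i_n}\in B$ are arbitrary (a choice is made for every index tuple, and statements are understood to hold for every choice). The pair $(x_1,x_2)$ is R-diagonal if (for every choice of inserted elements) there are $f,g\in\Theta_B^1$ with $R_{x_1,x_2}(z_1,z_2)=f(z_1z_2)+g(z_2z_1)$. *)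

theory Defs
  imports Complex_Main "HOL-Library.Disjoint_Sets"
begin

section \<open>Noncommutative probability spaces over a subalgebra\<close>

text \<open>The sort \<open>{ring, monoid_mult}\<close> is that of associative unital rings; unlike \<open>ring_1\<close> it
  does not require \<open>0 \<noteq> 1\<close>.\<close>

locale complex_algebra = vector_space scale
  for scale :: "complex \<Rightarrow> 'a::{ring, monoid_mult} \<Rightarrow> 'a" +
  assumes mult_scale_left: "scale c x * y = scale c (x * y)"
    and mult_scale_right: "x * scale c y = scale c (x * y)"

definition unital_subalgebra ::
  "(complex \<Rightarrow> 'a::{ring, monoid_mult} \<Rightarrow> 'a) \<Rightarrow> 'a set \<Rightarrow> bool" where
  "unital_subalgebra scale S \<longleftrightarrow>
     module.subspace scale S \<and> 1 \<in> S \<and> (\<forall>x\<in>S. \<forall>y\<in>S. x * y \<in> S)"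

locale nc_prob_space = complex_algebra scale
  for scale :: "complex \<Rightarrow> 'a::{ring, monoid_mult} \<Rightarrow> 'a" +
  fixes B :: "'a set" and \<phi> :: "'a \<Rightarrow> 'a"
  assumes subalgebra_B: "unital_subalgebra scale B"
    and phi_in_B: "\<phi> x \<in> B"
    and phi_linear: "Vector_Spaces.linear scale scale \<phi>"
    and phi_B: "b \<in> B \<Longrightarrow> \<phi> b = b"
    and phi_bimodule: "b \<in> B \<Longrightarrow> b' \<in> B \<Longrightarrow> \<phi> (b * x * b') = b * \<phi> x * b'"

definition B_trace :: "('a::{ring, monoid_mult} \<Rightarrow> 'a) \<Rightarrow> bool" where
  "B_trace \<phi> \<longleftrightarrow> (\<forall>x y. \<phi> (x * y) = \<phi> (y * x))"

text \<open>The list \<open>bs\<close> is \<open>b\<^sub>2, \<dots>, b\<^sub>m\<close>.\<close>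

definition B_even :: "'a::{ring, monoid_mult} set \<Rightarrow> ('a \<Rightarrow> 'a) \<Rightarrow> 'a \<Rightarrow> bool" where
  "B_even B \<phi> a \<longleftrightarrow>
     (\<forall>bs. set bs \<subseteq> B \<longrightarrow> odd (length bs + 1) \<longrightarrow> \<phi> (a * prod_list (map (\<lambda>b. b * a) bs)) = 0)"

definition free_amalgamated ::
  "('a::{ring, monoid_mult} \<Rightarrow> 'a) \<Rightarrow> 'i set \<Rightarrow> ('i \<Rightarrow> 'a set) \<Rightarrow> bool" where
  "free_amalgamated \<phi> I \<A> \<longleftrightarrow>
     (\<forall>w :: ('i \<times> 'a) list. w \<noteq> [] \<longrightarrow> distinct_adj (map fst w) \<longrightarrow>
        (\<forall>(i, x)\<in>set w. i \<in> I \<and> x \<in> \<A> i \<and> \<phi> x = 0) \<longrightarrow> \<phi> (prod_list (map snd w)) = 0)"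

definition free_over ::
  "(complex \<Rightarrow> 'a::{ring, monoid_mult} \<Rightarrow> 'a) \<Rightarrow> 'a set \<Rightarrow> ('a \<Rightarrow> 'a) \<Rightarrow> 'a \<Rightarrow> 'a \<Rightarrow> bool" where
  "free_over scale B \<phi> a a' \<longleftrightarrow>
     free_amalgamated \<phi> {1, 2 :: nat}
       (\<lambda>i. unital_subalgebra scale hull (B \<union> {if i = 1 then a else a'}))"


section \<open>Noncrossing partitions\<close>

definition noncrossing :: "nat set set \<Rightarrow> bool" where
  "noncrossing \<pi> \<longleftrightarrow>
     (\<forall>V\<in>\<pi>. \<forall>W\<in>\<pi>. \<forall>i\<in>V. \<forall>j\<in>W. \<forall>k\<in>V. \<forall>l\<in>W. i < j \<and> j < k \<and> k < l \<longrightarrow> V = W)"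

definition NC :: "nat \<Rightarrow> nat set set set" where
  "NC n = {\<pi>. partition_on {1..n} \<pi> \<and> noncrossing \<pi>}"

lemma finite_NC: "finite (NC n)"
  by (rule finite_subset[OF _ finitely_many_partition_on[of "{1..n}"]]) (auto simp: NC_def)

text \<open>The Moebius function of the finite poset \<open>NC n\<close> ordered by refinement, by the recursion
  \<open>\<mu>(\<pi>, \<pi>) = 1\<close> and \<open>\<Sum>\<^bsub>\<pi> \<le> \<tau> \<le> \<sigma>\<^esub> \<mu>(\<pi>, \<tau>) = 0\<close> for \<open>\<pi> < \<sigma>\<close>.\<close>

function NC_moebius :: "nat \<Rightarrow> nat set set \<Rightarrow> nat set set \<Rightarrow> int" where
  "NC_moebius n \<pi> \<sigma> =
     (if \<pi> \<notin> NC n \<or> \<sigma> \<notin> NC n \<or> \<not> refines {1..n} \<pi> \<sigma> then 0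
      else if \<pi> = \<sigma> then 1
      else - (\<Sum>\<tau>\<in>{\<tau> \<in> NC n. refines {1..n} \<pi> \<tau> \<and> refines {1..n} \<tau> \<sigma> \<and> \<tau> \<noteq> \<sigma>}. NC_moebius n \<pi> \<tau>))"
  by pat_completeness auto
termination
proof (relation "measure (\<lambda>(n, \<pi>, \<sigma>). card {\<rho> \<in> NC n. refines {1..n} \<rho> \<sigma>})", goal_cases)
  case (2 n \<pi> \<sigma> \<tau>)
  then have \<tau>: "refines {1..n} \<tau> \<sigma>" "\<tau> \<noteq> \<sigma>" and \<sigma>: "\<sigma> \<in> NC n" "refines {1..n} \<sigma> \<sigma>"
    by (auto intro: refines_refl simp: NC_def)
  have "\<sigma> \<in> {\<rho> \<in> NC n. refines {1..n} \<rho> \<sigma>} - {\<rho> \<in> NC n. refines {1..n} \<rho> \<tau>}"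
    using \<sigma> refines_asym[OF \<tau>(1)] \<tau>(2) by blast
  moreover have "{\<rho> \<in> NC n. refines {1..n} \<rho> \<tau>} \<subseteq> {\<rho> \<in> NC n. refines {1..n} \<rho> \<sigma>}"
    using refines_trans[OF _ \<tau>(1)] by blast
  ultimately have "{\<rho> \<in> NC n. refines {1..n} \<rho> \<tau>} \<subset> {\<rho> \<in> NC n. refines {1..n} \<rho> \<sigma>}"
    by blast
  then have "card {\<rho> \<in> NC n. refines {1..n} \<rho> \<tau>} < card {\<rho> \<in> NC n. refines {1..n} \<rho> \<sigma>}"
    using finite_NC[of n] by (intro psubset_card_mono) simp
  then show ?case
    by simp
qed auto

declare NC_moebius.simps [simp del]


section \<open>Partitioned moments and cumulants\<close>

definition ordered_prod :: "(nat \<Rightarrow> 'a::monoid_mult) \<Rightarrow> nat set \<Rightarrow> 'a" where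
  "ordered_prod a S = prod_list (map a (sorted_list_of_set S))"

text \<open>The following functions take a partition \<open>\<pi>\<close> of any finite set \<open>\<Union>\<pi>\<close> of naturals, so that
  after the removal of a block the remaining indices need not be renumbered. Accordingly, intervals
  and neighbours are taken relative to \<open>\<Union>\<pi>\<close>.\<close>

definition interval_block :: "nat set set \<Rightarrow> nat set \<Rightarrow> bool" where
  "interval_block \<pi> V \<longleftrightarrow> V \<in> \<pi> \<and> (\<forall>i\<in>V. \<forall>k\<in>V. \<forall>j\<in>\<Union>\<pi>. i < j \<and> j < k \<longrightarrow> j \<in> V)"

text \<open>The arguments left after removing the block \<open>V\<close>, where \<open>S\<close> is the set of remaining indices:
  \<open>\<beta>\<close> is absorbed by the nearest remaining index to the left of \<open>V\<close>, or, if there is none, by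
  the first remaining index (which is then to the right of \<open>V\<close>).\<close>

definition absorb ::
  "nat set \<Rightarrow> nat set \<Rightarrow> 'a::monoid_mult \<Rightarrow> (nat \<Rightarrow> 'a) \<Rightarrow> nat \<Rightarrow> 'a" where
  "absorb S V \<beta> a =
     (if \<exists>l\<in>S. l < Min V
      then let l = Max {l \<in> S. l < Min V} in a(l := a l * \<beta>)
      else let r = Min S in a(r := \<beta> * a r))"

text \<open>On noncrossing partitions with at least two blocks an interval block always exists, and the
  value does not depend on which one is chosen. The last branch covers \<open>\<pi> = 1\<^sub>n\<close>; its values on
  other arguments, such as partitions with crossings, are immaterial.\<close>

function phi_hat ::
  "('a::monoid_mult \<Rightarrow> 'a) \<Rightarrow> nat set set \<Rightarrow> (nat \<Rightarrow> 'a) \<Rightarrow> 'a" where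
  "phi_hat \<phi> \<pi> a =
     (if card \<pi> > 1 \<and> (\<exists>V. interval_block \<pi> V)
      then let V = (SOME V. interval_block \<pi> V)
           in phi_hat \<phi> (\<pi> - {V}) (absorb (\<Union>\<pi> - V) V (\<phi> (ordered_prod a V)) a)
      else \<phi> (ordered_prod a (\<Union>\<pi>)))"
  by pat_completeness auto
termination
proof (relation "measure (\<lambda>(\<phi>, \<pi>, a). card \<pi>)", goal_cases)
  case (2 \<phi> \<pi> a V)
  then have "interval_block \<pi> V" and \<pi>: "card \<pi> > 1"
    by (auto intro: someI_ex)
  then have "V \<in> \<pi>"
    by (simp add: interval_block_def)
  moreover have "finite \<pi>"
    using \<pi> by (intro card_ge_0_finite) simp
  ultimately have "card (\<pi> - {V}) < card \<pi>"
    by (intro card_Diff1_less)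
  then show ?case
    by simp
qed auto

declare phi_hat.simps [simp del]

text \<open>\<open>c\<^sup>(\<^sup>n\<^sup>)(a 1 \<otimes> \<dots> \<otimes> a n)\<close>\<close>

definition cumulant ::
  "(complex \<Rightarrow> 'a::{ring, monoid_mult} \<Rightarrow> 'a) \<Rightarrow> ('a \<Rightarrow> 'a) \<Rightarrow> nat \<Rightarrow> (nat \<Rightarrow> 'a) \<Rightarrow> 'a" where
  "cumulant scale \<phi> n a =
     (\<Sum>\<pi>\<in>NC n. scale (of_int (NC_moebius n \<pi> {{1..n}})) (phi_hat \<phi> \<pi> a))"


section \<open>Formal series, R-transforms and R-diagonal pairs\<close>

text \<open>A series in the noncommuting indeterminates \<open>z\<^sub>1, \<dots>, z\<^sub>s\<close> is given by its coefficients: the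
  coefficient at the word \<open>[i\<^sub>1, \<dots>, i\<^sub>n]\<close> is that of \<open>z\<^bsub>i\<^sub>1\<^esub> \<cdots> z\<^bsub>i\<^sub>n\<^esub>\<close>.\<close>

definition words :: "nat \<Rightarrow> nat list set" where
  "words s = {w. w \<noteq> [] \<and> set w \<subseteq> {1..s}}"

definition Theta :: "'a::zero set \<Rightarrow> nat \<Rightarrow> (nat list \<Rightarrow> 'a) set" where
  "Theta B s = {f. (\<forall>w\<in>words s. f w \<in> B) \<and> (\<forall>w. w \<notin> words s \<longrightarrow> f w = 0)}"

text \<open>The series \<open>f(z\<^bsub>u\<^sub>1\<^esub> \<cdots> z\<^bsub>u\<^sub>r\<^esub>)\<close> for a one-variable series \<open>f\<close> and a nonempty word \<open>u\<close>. The
  sum has at most one term, since \<open>u\<^sup>m\<close> determines \<open>m\<close>.\<close>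

definition subst_monomial ::
  "(nat list \<Rightarrow> 'a::comm_monoid_add) \<Rightarrow> nat list \<Rightarrow> nat list \<Rightarrow> 'a" where
  "subst_monomial f u = (\<lambda>w. \<Sum>m | m \<ge> 1 \<and> concat (replicate m u) = w. f (replicate m 1))"

text \<open>The inserted elements \<open>b\<^bsub>i\<^sub>2\<^esub>, \<dots>, b\<^bsub>i\<^sub>n\<^esub>\<close> chosen for the index tuple \<open>w\<close> are
  \<open>\<beta> w 2, \<dots>, \<beta> w n\<close>.\<close>

definition insertions :: "'a set \<Rightarrow> nat \<Rightarrow> (nat list \<Rightarrow> nat \<Rightarrow> 'a) set" where
  "insertions B s = {\<beta>. \<forall>w\<in>words s. \<forall>j\<in>{2..length w}. \<beta> w j \<in> B}"

text \<open>In \<open>R_transform\<close> the list \<open>xs\<close> is \<open>x\<^sub>1, \<dots>, x\<^sub>s\<close>; list positions start at \<open>0\<close>, indices at \<open>1\<close>.\<close>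

definition R_transform ::
  "(complex \<Rightarrow> 'a::{ring, monoid_mult} \<Rightarrow> 'a) \<Rightarrow> ('a \<Rightarrow> 'a) \<Rightarrow> (nat list \<Rightarrow> nat \<Rightarrow> 'a) \<Rightarrow> 'a list \<Rightarrow>
     nat list \<Rightarrow> 'a" where
  "R_transform scale \<phi> \<beta> xs = (\<lambda>w.
     if w \<in> words (length xs)
     then cumulant scale \<phi> (length w)
            (\<lambda>j. let x = xs ! (w ! (j - 1) - 1) in if j = 1 then x else \<beta> w j * x)
     else 0)"

definition R_diagonal ::
  "(complex \<Rightarrow> 'a::{ring, monoid_mult} \<Rightarrow> 'a) \<Rightarrow> 'a set \<Rightarrow> ('a \<Rightarrow> 'a) \<Rightarrow> 'a \<Rightarrow> 'a \<Rightarrow> bool" where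
  "R_diagonal scale B \<phi> x\<^sub>1 x\<^sub>2 \<longleftrightarrow>
     (\<forall>\<beta>\<in>insertions B 2. \<exists>f\<in>Theta B 1. \<exists>g\<in>Theta B 1.
        R_transform scale \<phi> \<beta> [x\<^sub>1, x\<^sub>2] =
          (\<lambda>w. subst_monomial f [1, 2] w + subst_monomial g [2, 1] w))"

end

(*
  Write x_u = c u * c (\<not> u), so that x_True = a * a' and x_False = a' * a. Cut a word in these letters
  (with coefficients from B) into its maximal alternating runs. By evenness and freeness the product
  of a run minus its expectation is a sum of alternating products of centred elements, beginning in
  the algebra of the first factor of the run and ending in that of its last factor. Two consecutive
  runs meet at equal letters u u, that is at ... c (\<not> u) * c u ..., so a product of centred runs
  is again of this form and has expectation 0. Expanding the centring of all runs but the first inside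
  one block V of a noncrossing partition \<sigma> gives a linear relation between partitioned moments, which
  in terms of the Moebius inverse K of phi_hat reads: the sum of K \<pi> over all \<pi> \<le> \<sigma> for which no
  such run is a union of blocks of \<pi> vanishes. If all blocks of \<pi> are alternating of even length, then
  removing interval blocks one at a time shows that some such run is a union of blocks. Hence by
  induction K \<sigma> = 0 as soon as some block of \<sigma> is not alternating of even length, and
  K {{1..n}} is the cumulant.
*)
theory Submission
  imports Defs
begin

section \<open>Algebras generated by the two elements\<close>


text \<open>Only the cumulant at \<open>{{1..n}}\<close> is wanted, but the relation for
  \<open>\<sigma>\<close> involves finer partitions, so vanishing is proved for every
  \<open>\<sigma>\<close> with a bad block. This bypasses any factorization of \<open>K\<close> over
  blocks, which would be nested over \<open>B\<close>. Leaving the first run uncentred shapes the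
  argument. The expectation of each later run finds an index of \<open>V\<close> on its left to
  absorb it, and what remains of \<open>V\<close> is never empty. Moreover \<open>K \<sigma>\<close>
  stays in the relation, because a later run is a proper part of the block \<open>V\<close>. The
  price is small: the expectation of the first run comes out on the left as an element of
  \<open>B\<close>, and the other centred runs still multiply to expectation 0. If \<open>V\<close>
  is a single run, badness means odd length. Such a run starts in one algebra and ends in the other,
  so its expectation itself vanishes. The blocks other than \<open>V\<close> have to be removed in
  an order adapted to \<open>V\<close>, whereas \<open>phi_hat\<close> picks its interval blocks by
  \<open>SOME\<close>; hence the independence of that choice is needed, and it comes from the
  bimodule property.\<close>

context nc_prob_space
begin

lemma B_0 [simp]: "0 \<in> B" and B_1 [simp]: "1 \<in> B"
  and B_mult [simp]: "x \<in> B \<Longrightarrow> y \<in> B \<Longrightarrow> x * y \<in> B"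
  and B_add [simp]: "x \<in> B \<Longrightarrow> y \<in> B \<Longrightarrow> x + y \<in> B"
  and B_uminus [simp]: "x \<in> B \<Longrightarrow> - x \<in> B"
  and B_scale [simp]: "x \<in> B \<Longrightarrow> scale r x \<in> B"
proof -
  have B: "subspace B"
    using subalgebra_B by (simp add: unital_subalgebra_def)
  show "0 \<in> B" "x \<in> B \<Longrightarrow> y \<in> B \<Longrightarrow> x + y \<in> B" "x \<in> B \<Longrightarrow> - x \<in> B" "x \<in> B \<Longrightarrow> scale r x \<in> B"
    using B by (simp_all add: subspace_0 subspace_add subspace_neg subspace_scale)
  show "1 \<in> B" "x \<in> B \<Longrightarrow> y \<in> B \<Longrightarrow> x * y \<in> B"
    using subalgebra_B by (auto simp: unital_subalgebra_def)
qed

declare phi_in_B [simp] phi_B [simp]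

lemma phi_add: "\<phi> (x + y) = \<phi> x + \<phi> y"
proof -
  interpret Vector_Spaces.linear scale scale \<phi> by (rule phi_linear)
  show ?thesis by (rule add)
qed

lemma phi_diff: "\<phi> (x - y) = \<phi> x - \<phi> y"
proof -
  interpret Vector_Spaces.linear scale scale \<phi> by (rule phi_linear)
  show ?thesis by (rule diff)
qed

lemma phi_mult_left: "b \<in> B \<Longrightarrow> \<phi> (b * x) = b * \<phi> x"
  using phi_bimodule[of b 1 x] by simp

lemma phi_mult_right: "b \<in> B \<Longrightarrow> \<phi> (x * b) = \<phi> x * b"
  using phi_bimodule[of 1 b x] by simp

end

lemma unital_subalgebra_hull:
  assumes "complex_algebra scale"
  shows "unital_subalgebra scale (unital_subalgebra scale hull X)"
proof -
  interpret complex_algebra scale by fact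
  have *: "subspace t" if "unital_subalgebra scale t" for t
    using that by (simp add: unital_subalgebra_def)
  show ?thesis
    unfolding unital_subalgebra_def hull_def
    by (auto intro!: subspace_Inter simp: *; auto simp: unital_subalgebra_def)
qed

text \<open>Indexing by \<open>bool\<close> makes the other element \<open>c (\<not> i)\<close>, so
  that alternation is expressed by negation.\<close>

locale free_even_pair = nc_prob_space scale B \<phi>
  for scale :: "complex \<Rightarrow> 'a::{ring, monoid_mult} \<Rightarrow> 'a" and B \<phi> +
  fixes c :: "bool \<Rightarrow> 'a"
  assumes even_c: "B_even B \<phi> (c i)"
    and free_c: "free_amalgamated \<phi> UNIV (\<lambda>i. unital_subalgebra scale hull (B \<union> {c i}))"
begin

definition alg :: "bool \<Rightarrow> 'a set" where
  "alg i = unital_subalgebra scale hull (B \<union> {c i})"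

lemma alg_add: "x \<in> alg i \<Longrightarrow> y \<in> alg i \<Longrightarrow> x + y \<in> alg i"
  and alg_mult: "x \<in> alg i \<Longrightarrow> y \<in> alg i \<Longrightarrow> x * y \<in> alg i"
proof -
  have alg: "unital_subalgebra scale (alg i)"
    unfolding alg_def by (rule unital_subalgebra_hull) unfold_locales
  show "x \<in> alg i \<Longrightarrow> y \<in> alg i \<Longrightarrow> x + y \<in> alg i"
    using alg by (auto simp: unital_subalgebra_def subspace_add)
  show "x \<in> alg i \<Longrightarrow> y \<in> alg i \<Longrightarrow> x * y \<in> alg i"
    using alg by (auto simp: unital_subalgebra_def)
qed

lemma B_subset_alg: "b \<in> B \<Longrightarrow> b \<in> alg i" and c_in_alg: "c i \<in> alg i"
  unfolding alg_def by (auto intro: hull_inc)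

text \<open>\<open>poly i True\<close> and \<open>poly i False\<close> are the even and the odd part of the algebra generated
  by \<open>B\<close> and \<open>c i\<close>; the sum of the two parts need not be direct.\<close>

inductive poly :: "bool \<Rightarrow> bool \<Rightarrow> 'a \<Rightarrow> bool" for i where
  base: "b \<in> B \<Longrightarrow> poly i True b"
| step: "poly i p x \<Longrightarrow> b \<in> B \<Longrightarrow> poly i (\<not> p) (x * c i * b)"
| add: "poly i p x \<Longrightarrow> poly i p y \<Longrightarrow> poly i p (x + y)"

lemma poly_in_alg: "poly i p x \<Longrightarrow> x \<in> alg i"
  by (induction rule: poly.induct) (auto intro: B_subset_alg c_in_alg alg_mult alg_add)

lemma poly_mult_B: "poly i p x \<Longrightarrow> b \<in> B \<Longrightarrow> poly i p (x * b)"
proof (induction rule: poly.induct)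
  case (step p x b')
  then show ?case
    using poly.step[of i p x "b' * b"] by (simp add: mult.assoc)
qed (auto simp: distrib_right intro: poly.intros)

text \<open>With \<open>True\<close> for even, the parity of a product is
  \<open>p = q\<close>.\<close>

lemma poly_mult: "poly i q y \<Longrightarrow> poly i p x \<Longrightarrow> poly i (p = q) (x * y)"
proof (induction rule: poly.induct)
  case (base b)
  then show ?case by (simp add: poly_mult_B)
next
  case (step q y b)
  then have "poly i (\<not> (p = q)) (x * y * c i * b)"
    by (intro poly.step)
  moreover have "(\<not> (p = q)) = (p = (\<not> q))"
    by auto
  ultimately show ?case
    by (simp add: mult.assoc)
qed (auto simp: distrib_left intro: poly.add)

lemma poly_B_mult: "poly i p x \<Longrightarrow> b \<in> B \<Longrightarrow> poly i p (b * x)"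
  using poly_mult[of i p x True b] poly.base[of b i] by auto

lemma c_in_poly: "poly i False (c i)"
  using poly.step[OF poly.base[of 1 i], of 1] by simp

text \<open>The list \<open>bs\<close> is an accumulator: the induction strips factors
  \<open>c i\<close> off the right end of \<open>x\<close> and stores them with their coefficients,
  until only an element of \<open>B\<close> is left and evenness applies. The parity condition says
  that the total number of factors \<open>c i\<close> is odd.\<close>

lemma phi_odd: "poly i p x \<Longrightarrow> set bs \<subseteq> B \<Longrightarrow> p = odd (length bs) \<Longrightarrow>
    \<phi> (x * prod_list (map (\<lambda>b. c i * b) bs)) = 0"
proof (induction arbitrary: bs rule: poly.induct)
  case (base b)
  then have "bs \<noteq> []"
    by auto
  then obtain bs' b' where bs: "bs = bs' @ [b']"
    by (metis rev_exhaust)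
  \<comment> \<open>\<open>B_even\<close> has coefficients only between the factors, while here each
    factor is followed by one. The last coefficient \<open>b'\<close> is left over and comes out on
    the right.\<close>
  have shift: "prod_list (map (\<lambda>b. c i * b) bs') * c i = c i * prod_list (map (\<lambda>b. b * c i) bs')"
    for bs' by (induction bs') (auto simp: mult.assoc)
  have "b * prod_list (map (\<lambda>b. c i * b) bs) = b * (c i * prod_list (map (\<lambda>b. b * c i) bs')) * b'"
    by (simp add: bs mult.assoc shift flip: shift)
  moreover have "\<phi> (c i * prod_list (map (\<lambda>b. b * c i) bs')) = 0"
    using even_c[of i] base bs by (auto simp: B_even_def)
  ultimately show ?case
    using base bs by (simp add: phi_bimodule)
next
  case (step x p b)
  show ?case
    using step.IH[of "b # bs"] step.hyps step.prems by (simp add: mult.assoc)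
qed (auto simp: distrib_right phi_add)

lemma phi_poly_odd: "poly i False x \<Longrightarrow> \<phi> x = 0"
  using phi_odd[of i False x "[]"] by simp

lemma poly_center: "poly i True x \<Longrightarrow> poly i True (x - \<phi> x)"
  using poly.add[of i True x "- \<phi> x"] by (simp add: poly.base)

lemma phi_center: "\<phi> (x - \<phi> x) = 0"
  by (simp add: phi_diff)

text \<open>The first index of \<open>alt j i\<close> and of \<open>tail j i\<close> is that of the last factor of the products, the
  second one that of the first factor.\<close>

inductive alt :: "bool \<Rightarrow> bool \<Rightarrow> 'a \<Rightarrow> bool" for j where
  single: "x \<in> alg j \<Longrightarrow> \<phi> x = 0 \<Longrightarrow> alt j j x"
| cons: "x \<in> alg i \<Longrightarrow> \<phi> x = 0 \<Longrightarrow> alt j (\<not> i) y \<Longrightarrow> alt j i (x * y)"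
| add: "alt j i x \<Longrightarrow> alt j i y \<Longrightarrow> alt j i (x + y)"

text \<open>Sums may occur at any depth of a product, while freeness speaks of single words. The
  prefix \<open>w\<close> collects the factors already stripped off, so that the case of a sum is
  mere additivity.\<close>

lemma phi_alt_aux:
  assumes "alt j i t" "distinct_adj (map fst w)" "\<forall>(k, x)\<in>set w. x \<in> alg k \<and> \<phi> x = 0"
    "w \<noteq> [] \<Longrightarrow> fst (last w) \<noteq> i"
  shows "\<phi> (prod_list (map snd w) * t) = 0"
  using assms
proof (induction arbitrary: w rule: alt.induct)
  case (single x)
  have "\<phi> (prod_list (map snd (w @ [(j, x)]))) = 0"
    using free_c single unfolding free_amalgamated_def alg_def[symmetric]
    by (elim allE[of _ "w @ [(j, x)]"]) (cases "w = []", auto simp: distinct_adj_append_iff last_map)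
  then show ?case by simp
next
  case (cons x i y)
  have "\<phi> (prod_list (map snd (w @ [(i, x)])) * y) = 0"
    using cons.hyps cons.prems by (intro cons.IH) (cases "w = []", auto simp: distinct_adj_append_iff last_map)
  then show ?case by (simp add: mult.assoc)
qed (simp add: distrib_left phi_add)

lemma phi_alt: "alt j i t \<Longrightarrow> \<phi> t = 0"
  using phi_alt_aux[of j i t "[]"] by simp

lemma alt_mult: "alt j i x \<Longrightarrow> alt k (\<not> j) y \<Longrightarrow> alt k i (x * y)"
  by (induction rule: alt.induct) (auto simp: mult.assoc distrib_right intro: alt.intros)

text \<open>A run regroups into an odd factor, even factors such as \<open>c i * b * c i\<close>,
  and a final odd factor. This is the shape of what follows the first factor once the even ones are
  centred.\<close>

inductive tail :: "bool \<Rightarrow> bool \<Rightarrow> 'a \<Rightarrow> bool" for j where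
  single: "poly j False x \<Longrightarrow> tail j j x"
| cons: "poly i True x \<Longrightarrow> \<phi> x = 0 \<Longrightarrow> tail j (\<not> i) y \<Longrightarrow> tail j i (x * y)"
| add: "tail j i x \<Longrightarrow> tail j i y \<Longrightarrow> tail j i (x + y)"

lemma tail_in_alt: "tail j i x \<Longrightarrow> alt j i x"
  by (induction rule: tail.induct) (auto intro: alt.intros poly_in_alg phi_poly_odd)

lemma tail_B_mult: "tail j i x \<Longrightarrow> b \<in> B \<Longrightarrow> tail j i (b * x)"
proof (induction rule: tail.induct)
  case (cons i x y)
  then have "tail j i ((b * x) * y)"
    by (intro tail.cons) (auto intro: poly_B_mult simp: phi_mult_left)
  then show ?case by (simp add: mult.assoc)
qed (auto simp: distrib_left intro: tail.intros poly_B_mult)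

lemma zero_in_tail: "tail j i 0"
proof -
  have "poly j False 0" for j
    using poly_B_mult[OF c_in_poly, of 0 j] by simp
  then have *: "tail j j 0" for j
    by (rule tail.single)
  show ?thesis
  proof (cases "i = j")
    case False
    then have "(\<not> i) = j" by auto
    moreover have "poly i True 0"
      by (simp add: poly.base)
    ultimately show ?thesis
      using tail.cons[of i 0 j 0] * by simp
  qed (use * in simp)
qed

text \<open>Centring an even factor leaves a \<open>B\<close>-multiple of what follows it, and this
  starts in the other algebra. Hence only the sum of both kinds of tails is closed under
  multiplication by even elements.\<close>

definition tails :: "bool \<Rightarrow> 'a set" where
  "tails j = {x + y | x y. tail j True x \<and> tail j False y}"

lemma tails_add: "x \<in> tails j \<Longrightarrow> y \<in> tails j \<Longrightarrow> x + y \<in> tails j"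
proof -
  assume "x \<in> tails j" "y \<in> tails j"
  then obtain x1 x2 y1 y2 where xy: "x = x1 + x2" "y = y1 + y2"
      "tail j True x1" "tail j False x2" "tail j True y1" "tail j False y2"
    unfolding tails_def by blast
  have "x + y = (x1 + y1) + (x2 + y2)"
    by (simp add: xy)
  with tail.add[OF xy(3,5)] tail.add[OF xy(4,6)] show "x + y \<in> tails j"
    unfolding tails_def by blast
qed

lemma tail_in_tails: "tail j i x \<Longrightarrow> x \<in> tails j"
proof -
  assume "tail j i x"
  then have "\<exists>y z. x = y + z \<and> tail j True y \<and> tail j False z"
    using zero_in_tail[of j] by (intro exI[of _ "if i then x else 0"] exI[of _ "if i then 0 else x"]) auto
  then show "x \<in> tails j"
    by (auto simp: tails_def)
qed

lemma poly_mult_tail_neq: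
  assumes "poly i True e" "tail j (\<not> i) y"
  shows "e * y \<in> tails j"
proof -
  have "(e - \<phi> e) * y \<in> tails j"
    using assms by (intro tail_in_tails tail.cons poly_center phi_center)
  moreover have "\<phi> e * y \<in> tails j"
    using assms by (intro tail_in_tails tail_B_mult) auto
  ultimately show ?thesis
    using tails_add by (metis diff_add_cancel distrib_right)
qed

lemma poly_mult_tail: "tail j k y \<Longrightarrow> poly i True e \<Longrightarrow> e * y \<in> tails j"
proof (induction rule: tail.induct)
  case (single y)
  show ?case
  proof (cases "i = j")
    case True
    then show ?thesis
      using single poly_mult[of i False y True e] by (auto intro: tail_in_tails tail.single)
  next
    case False
    then have "j = (\<not> i)" by auto
    with poly_mult_tail_neq[of i e j y] single tail.single[of j y] show ?thesis by auto
  qed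
next
  case (cons k x y)
  show ?case
  proof (cases "i = k")
    case True
    then show ?thesis
      using poly_mult_tail_neq[of i "e * x" j y] cons poly_mult[of i True x True e]
      by (auto simp: mult.assoc)
  next
    case False
    then have "k = (\<not> i)" by auto
    with poly_mult_tail_neq[of i e j "x * y"] cons tail.cons[of k x j y] show ?thesis by auto
  qed
qed (auto simp: distrib_left intro: tails_add)

lemma poly_mult_tails: "y \<in> tails j \<Longrightarrow> poly i True e \<Longrightarrow> e * y \<in> tails j"
proof -
  assume "y \<in> tails j" and e: "poly i True e"
  then obtain y1 y2 where "y = y1 + y2" "tail j True y1" "tail j False y2"
    unfolding tails_def by blast
  then show "e * y \<in> tails j"
    using e by (auto simp: distrib_left intro: tails_add poly_mult_tail)
qed

text \<open>Only an odd factor meeting a one-factor tail in the same algebra gives an even element,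
  whose expectation has to be split off. In all other cases the first factor remains odd and is
  centred by evenness. So a nonzero constant requires \<open>i = j\<close>.\<close>

lemma odd_mult_tail:
  "tail j k y \<Longrightarrow> poly i False x \<Longrightarrow> \<exists>\<beta>\<in>B. alt j i (x * y - \<beta>) \<and> (i \<noteq> j \<longrightarrow> \<beta> = 0)"
proof (induction rule: tail.induct)
  case (single y)
  show ?case
  proof (cases "i = j")
    case True
    then have "poly i True (x * y)"
      using single poly_mult[of i False y False x] by auto
    then have "alt j i (x * y - \<phi> (x * y))"
      using True by (auto intro!: alt.single poly_in_alg poly_center phi_center)
    then show ?thesis
      using True by (intro bexI[of _ "\<phi> (x * y)"]) auto
  next
    case False
    then have "alt j i (x * y)"
      using single by (intro alt.cons poly_in_alg[of i False x] phi_poly_odd[of i x])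
        (auto intro: alt.single poly_in_alg phi_poly_odd)
    then show ?thesis by (intro bexI[of _ 0]) auto
  qed
next
  case (cons k f y)
  have "alt j i (x * (f * y))"
  proof (cases "i = k")
    case True
    then have "poly i False (x * f)"
      using cons poly_mult[of i True f False x] by auto
    then have "alt j i ((x * f) * y)"
      using True cons by (intro alt.cons) (auto intro: poly_in_alg phi_poly_odd tail_in_alt)
    then show ?thesis by (simp add: mult.assoc)
  next
    case False
    then have "k = (\<not> i)" by auto
    then have "alt j (\<not> i) (f * y)"
      using tail_in_alt[OF tail.cons[of k f j y]] cons by metis
    then show ?thesis
      using cons.prems by (auto intro: alt.cons poly_in_alg phi_poly_odd)
  qed
  then show ?case by (intro bexI[of _ 0]) auto
next
  case (add k y1 y2)
  then obtain \<beta>1 \<beta>2 where \<beta>: "\<beta>1 \<in> B" "alt j i (x * y1 - \<beta>1)" "i \<noteq> j \<longrightarrow> \<beta>1 = 0"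
      "\<beta>2 \<in> B" "alt j i (x * y2 - \<beta>2)" "i \<noteq> j \<longrightarrow> \<beta>2 = 0"
    by metis
  then have "alt j i ((x * y1 - \<beta>1) + (x * y2 - \<beta>2))"
    by (intro alt.add)
  then show ?case
    using \<beta> by (intro bexI[of _ "\<beta>1 + \<beta>2"]) (auto simp: algebra_simps)
qed

text \<open>Coefficients are allowed on both sides because \<open>absorb\<close> multiplies
  arguments by elements of \<open>B\<close> from the right or from the left.\<close>

definition letter :: "bool \<Rightarrow> 'a set" where
  "letter u = {b * c u * c (\<not> u) * b' | b b'. b \<in> B \<and> b' \<in> B}"

lemma letter_B_mult: "x \<in> letter u \<Longrightarrow> b \<in> B \<Longrightarrow> b * x \<in> letter u"
  and letter_mult_B: "x \<in> letter u \<Longrightarrow> b \<in> B \<Longrightarrow> x * b \<in> letter u"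
  unfolding letter_def by (auto simp: mult.assoc) (metis B_mult mult.assoc)+

text \<open>In an alternating run the second factor of each letter and the first factor of the next
  one lie in the same algebra, so they merge into an even element.\<close>

lemma run_factorization:
  assumes "xs \<noteq> []" "distinct_adj (map w xs)" "\<forall>x\<in>set xs. a x \<in> letter (w x)"
  shows "\<exists>s t. poly (w (hd xs)) False s \<and> t \<in> tails (\<not> w (last xs)) \<and> prod_list (map a xs) = s * t"
  using assms
proof (induction xs rule: list_nonempty_induct)
  case (single x)
  then obtain b b' where b: "b \<in> B" "b' \<in> B" "a x = b * c (w x) * c (\<not> w x) * b'"
    by (auto simp: letter_def)
  have "poly (w x) False (b * c (w x))"
    using b by (intro poly_B_mult c_in_poly)
  moreover have "c (\<not> w x) * b' \<in> tails (\<not> w x)"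
    using b by (intro tail_in_tails[of _ "\<not> w x"] tail.single poly_mult_B c_in_poly)
  ultimately show ?case
    using b by (intro exI[of _ "b * c (w x)"] exI[of _ "c (\<not> w x) * b'"]) (simp add: mult.assoc)
next
  case (cons x xs)
  then obtain s t where st: "poly (w (hd xs)) False s" "t \<in> tails (\<not> w (last xs))"
      "prod_list (map a xs) = s * t"
    by (auto simp: distinct_adj_Cons)
  obtain b b' where b: "b \<in> B" "b' \<in> B" "a x = b * c (w x) * c (\<not> w x) * b'"
    using cons.prems by (auto simp: letter_def)
  have w: "w (hd xs) = (\<not> w x)"
    using cons by (auto simp: distinct_adj_Cons hd_map)
  have "poly (\<not> w x) True (c (\<not> w x) * b' * s)"
    using poly_mult[of "\<not> w x" False s False "c (\<not> w x) * b'"] st(1) b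
    by (simp add: w poly_mult_B c_in_poly)
  then have "c (\<not> w x) * b' * s * t \<in> tails (\<not> w (last xs))"
    using poly_mult_tails st(2) by blast
  moreover have "poly (w x) False (b * c (w x))"
    using b by (intro poly_B_mult c_in_poly)
  moreover have "prod_list (map a (x # xs)) = (b * c (w x)) * (c (\<not> w x) * b' * s * t)"
    by (simp add: b(3) st(3) mult.assoc)
  ultimately show ?case
    using cons.hyps by auto
qed

text \<open>The constants split off by \<open>odd_mult_tail\<close> add up to the expectation,
  because alternating products have expectation 0. If the end letters agree, the run starts and ends
  in different algebras and there is no constant.\<close>

lemma run_centered:
  assumes "xs \<noteq> []" "distinct_adj (map w xs)" "\<forall>x\<in>set xs. a x \<in> letter (w x)"
  shows "alt (\<not> w (last xs)) (w (hd xs)) (prod_list (map a xs) - \<phi> (prod_list (map a xs)))"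
    and "w (hd xs) = w (last xs) \<Longrightarrow> \<phi> (prod_list (map a xs)) = 0"
proof -
  define i j where "i = w (hd xs)" and "j = (\<not> w (last xs))"
  obtain s t where st: "poly i False s" "t \<in> tails j" "prod_list (map a xs) = s * t"
    using run_factorization[OF assms] by (auto simp: i_def j_def)
  from st(2) obtain t1 t2 where t: "t = t1 + t2" "tail j True t1" "tail j False t2"
    by (auto simp: tails_def)
  obtain \<beta>1 \<beta>2 where \<beta>: "\<beta>1 \<in> B" "alt j i (s * t1 - \<beta>1)" "i \<noteq> j \<longrightarrow> \<beta>1 = 0"
      "\<beta>2 \<in> B" "alt j i (s * t2 - \<beta>2)" "i \<noteq> j \<longrightarrow> \<beta>2 = 0"
    using odd_mult_tail st(1) t(2,3) by metis
  have "alt j i ((s * t1 - \<beta>1) + (s * t2 - \<beta>2))"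
    using \<beta> by (intro alt.add)
  then have alt: "alt j i (s * t - (\<beta>1 + \<beta>2))"
    by (simp add: t(1) algebra_simps)
  then have "\<phi> (s * t) = \<beta>1 + \<beta>2"
    using phi_alt[OF alt] \<beta> by (simp add: phi_diff)
  with alt \<beta> show "alt (\<not> w (last xs)) (w (hd xs)) (prod_list (map a xs) - \<phi> (prod_list (map a xs)))"
    and "w (hd xs) = w (last xs) \<Longrightarrow> \<phi> (prod_list (map a xs)) = 0"
    by (auto simp: st(3) i_def j_def)
qed

end

section \<open>Independence of the choice of interval blocks\<close>


lemma ordered_prod_cong: "(\<And>i. i \<in> V \<Longrightarrow> a i = a' i) \<Longrightarrow> ordered_prod a V = ordered_prod a' V"
  unfolding ordered_prod_def
  by (cases "finite V") (auto intro!: arg_cong[of _ _ prod_list] map_cong)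

lemma ordered_prod_Un:
  assumes "finite X" "finite Y" "\<forall>x\<in>X. \<forall>y\<in>Y. x < y"
  shows "ordered_prod a (X \<union> Y) = ordered_prod a X * ordered_prod a Y"
proof -
  have "sorted_list_of_set (X \<union> Y) = sorted_list_of_set X @ sorted_list_of_set Y"
    using assms
    by (intro sorted_distinct_set_unique) (auto simp: sorted_append intro: less_imp_le)
  then show ?thesis
    by (simp add: ordered_prod_def)
qed

lemma ordered_prod_split:
  assumes "finite V" "l \<in> V"
  shows "ordered_prod a V = ordered_prod a {i\<in>V. i < l} * a l * ordered_prod a {i\<in>V. l < i}"
proof -
  have "V = ({i\<in>V. i < l} \<union> {l}) \<union> {i\<in>V. l < i}"
    using assms(2) by auto
  then have "ordered_prod a V = ordered_prod a (({i\<in>V. i < l} \<union> {l}) \<union> {i\<in>V. l < i})"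
    by (rule arg_cong)
  also have "\<dots> = ordered_prod a {i\<in>V. i < l} * a l * ordered_prod a {i\<in>V. l < i}"
  proof -
    have "ordered_prod a (({i\<in>V. i < l} \<union> {l}) \<union> {i\<in>V. l < i}) =
        ordered_prod a ({i\<in>V. i < l} \<union> {l}) * ordered_prod a {i\<in>V. l < i}"
      using assms(1) by (intro ordered_prod_Un) auto
    moreover have "ordered_prod a ({i\<in>V. i < l} \<union> {l}) = ordered_prod a {i\<in>V. i < l} * ordered_prod a {l}"
      using assms(1) by (intro ordered_prod_Un) auto
    ultimately show ?thesis
      by (simp add: ordered_prod_def)
  qed
  finally show ?thesis .
qed

lemma ordered_prod_upd:
  assumes "finite V" "l \<in> V"
  shows "ordered_prod (a(l := x)) V = ordered_prod a {i\<in>V. i < l} * x * ordered_prod a {i\<in>V. l < i}"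
  unfolding ordered_prod_split[OF assms] by (auto intro!: arg_cong2[of _ _ _ _ "(*)"] ordered_prod_cong)

lemma ordered_prod_upd_right:
  assumes "finite V" "l \<in> V" "\<And>i. i \<in> V \<Longrightarrow> i \<le> l"
  shows "ordered_prod (a(l := a l * \<beta>)) V = ordered_prod a V * \<beta>"
proof -
  have "{i \<in> V. l < i} = {}"
    using assms(3) by fastforce
  then show ?thesis
    unfolding ordered_prod_upd[OF assms(1,2)] ordered_prod_split[OF assms(1,2), of a]
    by (simp only: sorted_list_of_set_empty ordered_prod_def list.map prod_list.Nil mult_1_right mult.assoc)
qed

lemma partition_on_remove:
  "partition_on S \<pi> \<Longrightarrow> V \<in> \<pi> \<Longrightarrow> partition_on (S - V) (\<pi> - {V})"
  by (auto simp: partition_on_def disjoint_def)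

lemma absorb_left:
  assumes "finite S" "l \<in> S" "l < Min V" "\<And>i. i \<in> S \<Longrightarrow> i < Min V \<Longrightarrow> i \<le> l"
  shows "absorb S V \<beta> a = a(l := a l * \<beta>)"
proof -
  have "Max {l \<in> S. l < Min V} = l"
    using assms by (intro Max_eqI) auto
  then show ?thesis
    using assms by (auto simp: absorb_def Let_def)
qed

lemma absorb_right:
  assumes "finite S" "r \<in> S" "\<And>i. i \<in> S \<Longrightarrow> \<not> i < Min V" "\<And>i. i \<in> S \<Longrightarrow> r \<le> i"
  shows "absorb S V \<beta> a = a(r := \<beta> * a r)"
proof -
  have "Min S = r"
    using assms by (intro Min_eqI) auto
  then show ?thesis
    using assms by (auto simp: absorb_def Let_def)
qed

lemma absorb_cong: "a i = a' i \<Longrightarrow> absorb S V \<beta> a i = absorb S V \<beta> a' i"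
  by (auto simp: absorb_def Let_def)

text \<open>Arguments keep stale values at removed indices; this permits ignoring or changing
  them.\<close>

lemma phi_hat_cong: "(\<And>i. i \<in> \<Union>\<pi> \<Longrightarrow> a i = a' i) \<Longrightarrow> phi_hat \<phi> \<pi> a = phi_hat \<phi> \<pi> a'"
proof (induction "card \<pi>" arbitrary: \<pi> a a' rule: less_induct)
  case less
  show ?case
  proof (cases "card \<pi> > 1 \<and> (\<exists>V. interval_block \<pi> V)")
    case True
    define V where "V = (SOME V. interval_block \<pi> V)"
    have "interval_block \<pi> V"
      unfolding V_def using True by (auto intro: someI_ex)
    then have V: "V \<in> \<pi>"
      by (simp add: interval_block_def)
    have prod: "ordered_prod a V = ordered_prod a' V"
      using V less.prems by (intro ordered_prod_cong) auto
    have "phi_hat \<phi> (\<pi> - {V}) (absorb (\<Union>\<pi> - V) V (\<phi> (ordered_prod a V)) a) =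
        phi_hat \<phi> (\<pi> - {V}) (absorb (\<Union>\<pi> - V) V (\<phi> (ordered_prod a' V)) a')"
    proof (rule less.hyps)
      show "card (\<pi> - {V}) < card \<pi>"
        using V True card_ge_0_finite[of \<pi>] by (intro card_Diff1_less) auto
    qed (auto simp: prod intro!: absorb_cong less.prems)
    then show ?thesis
      using True by (simp add: phi_hat.simps[of _ \<pi>] Let_def V_def)
  next
    case False
    then show ?thesis
      unfolding phi_hat.simps[of _ \<pi>] using less.prems by (auto intro: arg_cong[OF ordered_prod_cong])
  qed
qed

lemma phi_hat_single: "phi_hat \<phi> {V} a = \<phi> (ordered_prod a V)"
  by (simp add: phi_hat.simps)

lemma partition_on_blocks:
  assumes "partition_on S \<pi>" "finite S" "V \<in> \<pi>"
  shows "finite V" "V \<noteq> {}" "V \<subseteq> S" "finite \<pi>"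
  using assms finite_elements[OF assms(2,1)] by (auto simp: partition_on_def intro: finite_subset)

context nc_prob_space
begin

lemma absorb_cases:
  assumes "finite S" "S \<noteq> {}"
  obtains l where "l \<in> S" "l < Min V" "\<And>i. i \<in> S \<Longrightarrow> i < Min V \<Longrightarrow> i \<le> l"
      "\<And>\<beta> (a :: nat \<Rightarrow> 'a). absorb S V \<beta> a = a(l := a l * \<beta>)"
    | r where "r \<in> S" "\<And>i. i \<in> S \<Longrightarrow> \<not> i < Min V" "\<And>i. i \<in> S \<Longrightarrow> r \<le> i"
      "\<And>\<beta> (a :: nat \<Rightarrow> 'a). absorb S V \<beta> a = a(r := \<beta> * a r)"
proof (cases "\<exists>l\<in>S. l < Min V")
  case True
  define l where "l = Max {l \<in> S. l < Min V}"
  have fin: "finite {l \<in> S. l < Min V}"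
    using assms by simp
  have l: "l \<in> S" "l < Min V" "\<And>i. i \<in> S \<Longrightarrow> i < Min V \<Longrightarrow> i \<le> l"
    using Max_in[OF fin] True Max_ge[OF fin] unfolding l_def by blast+
  show ?thesis
    by (rule that(1)[OF l absorb_left[OF assms(1) l]])
next
  case False
  have r: "Min S \<in> S" "\<And>i. i \<in> S \<Longrightarrow> \<not> i < Min V" "\<And>i. i \<in> S \<Longrightarrow> Min S \<le> i"
    using assms False by auto
  show ?thesis
    by (rule that(2)[OF r absorb_right[OF assms(1) r]])
qed


lemma phi_ordered_prod_upd_right:
  assumes "finite V" "l \<in> V" "\<And>i. i \<in> V \<Longrightarrow> i \<le> l" "\<beta> \<in> B"
  shows "\<phi> (ordered_prod (a(l := a l * \<beta>)) V) = \<phi> (ordered_prod a V) * \<beta>"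
  using assms by (simp add: ordered_prod_upd_right phi_mult_right)

lemma phi_ordered_prod_upd_left:
  assumes "finite V" "l \<in> V" "\<And>i. i \<in> V \<Longrightarrow> l \<le> i" "\<beta> \<in> B"
  shows "\<phi> (ordered_prod (a(l := \<beta> * a l)) V) = \<beta> * \<phi> (ordered_prod a V)"
proof -
  have "{i \<in> V. i < l} = {}"
    using assms(3) by fastforce
  then have "ordered_prod (a(l := \<beta> * a l)) V = \<beta> * ordered_prod a V"
    unfolding ordered_prod_upd[OF assms(1,2)] ordered_prod_split[OF assms(1,2), of a]
    by (simp only: sorted_list_of_set_empty ordered_prod_def list.map prod_list.Nil mult_1_left mult.assoc)
  then show ?thesis
    using assms(4) by (simp add: phi_mult_left)
qed

lemma ordered_prod_upd_outside: "l \<notin> V \<Longrightarrow> ordered_prod (a(l := x)) V = ordered_prod a V"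
  by (rule ordered_prod_cong) auto

text \<open>If no index of \<open>S\<close> lies between the blocks, then \<open>W\<close> removed
  first is absorbed by the last index of \<open>V\<close>, and \<open>V\<close> removed first by the
  first index of \<open>W\<close>, unless \<open>S\<close> has an index to the left of
  \<open>V\<close>. The bimodule property pulls these expectations out again. If some index of
  \<open>S\<close> lies between, both expectations go directly to indices of \<open>S\<close>, and
  associativity covers the case that it is the same index.\<close>

lemma absorb_absorb:
  assumes fin: "finite S" "finite V" "finite W" and ne: "S \<noteq> {}" "V \<noteq> {}" "W \<noteq> {}"
    and disj: "S \<inter> V = {}" "S \<inter> W = {}" and VW: "\<forall>v\<in>V. \<forall>w\<in>W. v < w"
    and int: "\<forall>i\<in>V. \<forall>k\<in>V. \<forall>j\<in>S. \<not> (i < j \<and> j < k)" and "x \<in> S"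
  shows "absorb S V (\<phi> (ordered_prod (absorb (S \<union> V) W (\<phi> (ordered_prod a W)) a) V))
      (absorb (S \<union> V) W (\<phi> (ordered_prod a W)) a) x =
    absorb S W (\<phi> (ordered_prod (absorb (S \<union> W) V (\<phi> (ordered_prod a V)) a) W))
      (absorb (S \<union> W) V (\<phi> (ordered_prod a V)) a) x"
proof -
  define F where "F = (\<lambda>a V. \<phi> (ordered_prod a V))"
  have V: "Max V \<in> V" "Min V \<in> V" "\<And>i. i \<in> V \<Longrightarrow> i \<le> Max V" "\<And>i. i \<in> V \<Longrightarrow> Min V \<le> i"
    and W: "Min W \<in> W" "\<And>i. i \<in> W \<Longrightarrow> Min W \<le> i"
    using fin ne by auto
  then have VW': "Max V < Min W" "Min V < Min W" and nin: "Max V \<notin> S" "Min W \<notin> S" "Min W \<notin> V" "Max V \<notin> W"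
    using VW disj by (auto simp: disjoint_iff)
  have S_neq: "i \<notin> V" "i \<notin> W" "i \<noteq> Max V" "i \<noteq> Min W" if "i \<in> S" for i
    using that disj V W by (auto simp: disjoint_iff)
  have SV: "Max V < i \<longleftrightarrow> \<not> i < Min V" if "i \<in> S" for i
  proof -
    have "\<not> (Min V < i \<and> i < Max V)" "i \<noteq> Min V" "i \<noteq> Max V" "Min V \<le> Max V"
      using int that V S_neq[OF that] by blast+
    then show ?thesis by linarith
  qed
  have F_B: "F a' X \<in> B" for a' X
    by (simp add: F_def)
  have F_V: "F (a'(Max V := a' (Max V) * \<beta>)) V = F a' V * \<beta>" if "\<beta> \<in> B" for a' \<beta>
    unfolding F_def using fin V that by (intro phi_ordered_prod_upd_right) auto
  have F_W: "F (a'(Min W := \<beta> * a' (Min W))) W = \<beta> * F a' W" if "\<beta> \<in> B" for a' \<beta>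
    unfolding F_def using fin W that by (intro phi_ordered_prod_upd_left) auto
  have F_out: "F (a'(i := y)) V = F a' V" "F (a'(i := y)) W = F a' W" if "i \<in> S" for i a' y
    using S_neq[OF that] by (auto simp: F_def ordered_prod_upd_outside)
  have F_out': "F (a'(Min W := y)) V = F a' V" "F (a'(Max V := y)) W = F a' W" for a' y
    using nin by (auto simp: F_def ordered_prod_upd_outside)
  \<comment> \<open>The expectation of \<open>W\<close> goes to the nearest index of
    \<open>S\<close> between the blocks or, failing that (\<open>no_gap\<close>), to the last index
    of \<open>V\<close>.\<close>
  have gap: "absorb (S \<union> V) W \<beta> a' = a'(l := a' l * \<beta>)"
    if "l \<in> S" "\<not> l < Min V" "l < Min W" "\<And>i. i \<in> S \<Longrightarrow> i < Min W \<Longrightarrow> i \<le> l" for l \<beta> and a' :: "nat \<Rightarrow> 'a"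
  proof (rule absorb_left)
    have "Max V < l" using that SV by blast
    then show "i \<le> l" if "i \<in> S \<union> V" "i < Min W" for i
      using that \<open>\<And>i. i \<in> S \<Longrightarrow> i < Min W \<Longrightarrow> i \<le> l\<close> V(3)[of i] by auto
  qed (use that fin in auto)
  have no_gap: "absorb (S \<union> V) W \<beta> a' = a'(Max V := a' (Max V) * \<beta>)"
    if "\<And>i. i \<in> S \<Longrightarrow> i < Min W \<Longrightarrow> i < Min V" for \<beta> and a' :: "nat \<Rightarrow> 'a"
  proof (rule absorb_left)
    have "Min V \<le> Max V" using V by blast
    then show "i \<le> Max V" if "i \<in> S \<union> V" "i < Min W" for i
      using that \<open>\<And>i. i \<in> S \<Longrightarrow> i < Min W \<Longrightarrow> i < Min V\<close>[of i] V(3)[of i] by auto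
  qed (use V fin VW' in auto)
  from fin(1) ne(1) have "absorb S V (F (absorb (S \<union> V) W (F a W) a) V) (absorb (S \<union> V) W (F a W) a) x =
    absorb S W (F (absorb (S \<union> W) V (F a V) a) W) (absorb (S \<union> W) V (F a V) a) x"
  proof (cases rule: absorb_cases[of S V])
    case (1 l0)
    have V_out: "absorb (S \<union> W) V \<beta> a' = a'(l0 := a' l0 * \<beta>)" for \<beta> and a' :: "nat \<Rightarrow> 'a"
      using 1 fin VW V(2) by (intro absorb_left) (auto dest: less_asym)
    from fin(1) ne(1) show ?thesis
    proof (cases rule: absorb_cases[of S W])
      case (1 l1)
      show ?thesis
      proof (cases "l1 < Min V")
        case True
        then have "l1 = l0"
          using 1 \<open>l0 \<in> S\<close> \<open>l0 < Min V\<close> \<open>\<And>i. i \<in> S \<Longrightarrow> i < Min V \<Longrightarrow> i \<le> l0\<close> VW'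
          by (intro antisym) auto
        have "absorb (S \<union> V) W \<beta> a' = a'(Max V := a' (Max V) * \<beta>)" for \<beta> and a' :: "nat \<Rightarrow> 'a"
          using 1 True by (intro no_gap) (meson le_less_trans)
        then show ?thesis
          using \<open>l0 \<in> S\<close> \<open>x \<in> S\<close> S_neq
          by (auto simp: V_out 1(4) \<open>l1 = l0\<close> \<open>\<And>\<beta> a. absorb S V \<beta> a = a(l0 := a l0 * \<beta>)\<close>
              F_V F_W F_out F_out' F_B mult.assoc)
      next
        case False
        have "absorb (S \<union> V) W \<beta> a' = a'(l1 := a' l1 * \<beta>)" for \<beta> and a' :: "nat \<Rightarrow> 'a"
          using 1 False by (intro gap) auto
        then show ?thesis
          using \<open>l0 \<in> S\<close> \<open>l1 \<in> S\<close> \<open>l0 < Min V\<close> False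
          by (auto simp: V_out 1(4) \<open>\<And>\<beta> a. absorb S V \<beta> a = a(l0 := a l0 * \<beta>)\<close>
              F_V F_W F_out F_out' F_B mult.assoc)
      qed
    next
      case (2 r)
      then show ?thesis
        using \<open>l0 \<in> S\<close> \<open>l0 < Min V\<close> VW' by fastforce
    qed
  next
    case (2 r)
    from fin(1) ne(1) show ?thesis
    proof (cases rule: absorb_cases[of S W])
      case (1 l1)
      have "absorb (S \<union> V) W \<beta> a' = a'(l1 := a' l1 * \<beta>)" for \<beta> and a' :: "nat \<Rightarrow> 'a"
        using 1 2 by (intro gap) auto
      moreover have "absorb (S \<union> W) V \<beta> a' = a'(r := \<beta> * a' r)" for \<beta> and a' :: "nat \<Rightarrow> 'a"
      proof (rule absorb_right)
        have "r < Min W"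
          using 1 2(3)[of l1] by simp
        then show "r \<le> i" if "i \<in> S \<union> W" for i
          using that 2(3)[of i] W(2)[of i] by auto
        show "\<not> i < Min V" if "i \<in> S \<union> W" for i
          using that 2(2)[of i] W(2)[of i] VW' by auto
      qed (use 2 fin in auto)
      ultimately show ?thesis
        using \<open>l1 \<in> S\<close> \<open>r \<in> S\<close>
        by (auto simp: 1(4) 2(4) F_V F_W F_out F_out' F_B mult.assoc)
    next
      case (2 r')
      then have r': "r' = r"
        using \<open>r \<in> S\<close> \<open>\<And>i. i \<in> S \<Longrightarrow> r \<le> i\<close> by (intro antisym) auto
      have "absorb (S \<union> V) W \<beta> a' = a'(Max V := a' (Max V) * \<beta>)" for \<beta> and a' :: "nat \<Rightarrow> 'a"
        using 2 by (intro no_gap) auto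
      moreover have "absorb (S \<union> W) V \<beta> a' = a'(Min W := \<beta> * a' (Min W))" for \<beta> and a' :: "nat \<Rightarrow> 'a"
      proof (rule absorb_right)
        show "Min W \<le> i" if "i \<in> S \<union> W" for i
          using that 2(2)[of i] W(2)[of i] by auto
        show "\<not> i < Min V" if "i \<in> S \<union> W" for i
          using that 2(2)[of i] W(2)[of i] VW' by auto
      qed (use W fin in auto)
      ultimately show ?thesis
        using \<open>r \<in> S\<close> \<open>x \<in> S\<close> S_neq
        by (auto simp: 2(4) r' \<open>\<And>\<beta> a. absorb S V \<beta> a = a(r := \<beta> * a r)\<close>
            F_V F_W F_out F_out' F_B mult.assoc)
    qed
  qed
  then show ?thesis
    by (simp add: F_def)
qed

text \<open>The case in which nothing remains outside the two blocks: either order gives the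
  expectation over \<open>V\<close> times that over \<open>W\<close>.\<close>

lemma phi_hat_two_blocks:
  assumes "finite V" "finite W" "V \<noteq> {}" "W \<noteq> {}" "\<forall>v\<in>V. \<forall>w\<in>W. v < w"
  shows "phi_hat \<phi> {V} (absorb V W (\<phi> (ordered_prod a W)) a) =
    phi_hat \<phi> {W} (absorb W V (\<phi> (ordered_prod a V)) a)"
proof -
  have "absorb V W \<beta> a = a(Max V := a (Max V) * \<beta>)" for \<beta>
    using assms by (intro absorb_left) auto
  moreover have "absorb W V \<beta> a = a(Min W := \<beta> * a (Min W))" for \<beta>
    using assms by (intro absorb_right) (auto simp: not_less intro: less_imp_le)
  ultimately show ?thesis
    using assms by (simp add: phi_hat_single phi_ordered_prod_upd_left phi_ordered_prod_upd_right)
qed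

lemma interval_blocks_ordered:
  assumes "partition_on S \<pi>" "finite S" "interval_block \<pi> V" "interval_block \<pi> W" "V \<noteq> W"
  shows "(\<forall>v\<in>V. \<forall>w\<in>W. v < w) \<or> (\<forall>v\<in>V. \<forall>w\<in>W. w < v)"
proof -
  have VW: "V \<in> \<pi>" "W \<in> \<pi>"
    using assms by (auto simp: interval_block_def)
  then have sub: "V \<subseteq> \<Union>\<pi>" "W \<subseteq> \<Union>\<pi>"
    by auto
  have disj: "V \<inter> W = {}"
    using disjointD[OF partition_onD2[OF assms(1)]] VW assms(5) by blast
  have neq: "v \<noteq> w" if "v \<in> V" "w \<in> W" for v w
    using disj that by blast
  have "v' < w'" if "v \<in> V" "v' \<in> V" "w \<in> W" "w' \<in> W" "v < w" for v v' w w'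
  proof (rule ccontr)
    note vw = that
    assume "\<not> v' < w'"
    then have "w' < v'"
      using neq[of v' w'] that by linarith
    consider "w' < v" | "v < w'"
      using neq[of v w'] vw by linarith
    then show False
    proof cases
      case 1
      then have "v \<in> W"
        using assms(4) that sub unfolding interval_block_def by blast
      then show False using disj that by blast
    next
      case 2
      then have "w' \<in> V"
        using assms(3) that sub \<open>w' < v'\<close> unfolding interval_block_def by blast
      then show False using disj that by blast
    qed
  qed
  then show ?thesis
    using neq by (meson linorder_neqE_nat)
qed

lemma interval_block_remove: "interval_block \<pi> V \<Longrightarrow> V \<noteq> W \<Longrightarrow> interval_block (\<pi> - {W}) V"
  unfolding interval_block_def by blast

text \<open>A diamond argument. Let \<open>W\<close> be the block that the definition removes. Each
  of \<open>V\<close> and \<open>W\<close> is still an interval block once the other is gone, so by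
  induction both sides can continue with the missing one, and \<open>absorb_absorb\<close>
  identifies the results.\<close>

lemma phi_hat_interval_block:
  assumes "partition_on S \<pi>" "finite S" "interval_block \<pi> V" "\<pi> \<noteq> {V}"
  shows "phi_hat \<phi> \<pi> a = phi_hat \<phi> (\<pi> - {V}) (absorb (S - V) V (\<phi> (ordered_prod a V)) a)"
  using assms
proof (induction "card \<pi>" arbitrary: \<pi> S V a rule: less_induct)
  case less
  note part = less.prems(1) and fin = less.prems(2)
  have V: "V \<in> \<pi>" and S: "\<Union>\<pi> = S"
    using less.prems by (auto simp: interval_block_def partition_on_def)
  have "finite \<pi>"
    using partition_on_blocks[OF part fin V] by simp
  moreover obtain V' where "V' \<in> \<pi>" "V' \<noteq> V"
    using V less.prems(4) by blast
  ultimately have card: "card \<pi> > 1"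
    using V card_mono[of \<pi> "{V, V'}"] by simp
  define W where "W = (SOME V. interval_block \<pi> V)"
  have int_W: "interval_block \<pi> W"
    unfolding W_def using less.prems by (auto intro: someI_ex)
  then have W: "W \<in> \<pi>"
    by (simp add: interval_block_def)
  have phi_hat: "phi_hat \<phi> \<pi> a = phi_hat \<phi> (\<pi> - {W}) (absorb (S - W) W (\<phi> (ordered_prod a W)) a)"
    using card int_W by (auto simp: phi_hat.simps[of _ \<pi>] Let_def W_def S)
  show ?case
  proof (cases "V = W")
    case True
    then show ?thesis
      using phi_hat by simp
  next
    case False
    have blocks: "finite V" "V \<noteq> {}" "finite W" "W \<noteq> {}" "V \<subseteq> S" "W \<subseteq> S" "V \<inter> W = {}"
      using partition_on_blocks[OF part fin] V W False disjointD[OF partition_onD2[OF part]] by blast+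
    define T where "T = S - V - W"
    have T: "S - V = T \<union> W" "S - W = T \<union> V" "T \<union> V - V = T" "T \<union> W - W = T"
      using blocks by (auto simp: T_def)
    have ord: "(\<forall>v\<in>V. \<forall>w\<in>W. v < w) \<or> (\<forall>w\<in>W. \<forall>v\<in>V. w < v)"
      using interval_blocks_ordered[OF part fin less.prems(3) int_W False] by auto
    show ?thesis
    proof (cases "\<pi> = {V, W}")
      case True
      then have "\<pi> - {V} = {W}" "\<pi> - {W} = {V}" "T = {}"
        using False S by (auto simp: T_def)
      then show ?thesis
        unfolding phi_hat T(1,2) using ord phi_hat_two_blocks[of V W a] phi_hat_two_blocks[of W V a] blocks
        by simp metis
    next
      case more: False
      have ne: "\<pi> - {W} \<noteq> {V}" "\<pi> - {V} \<noteq> {W}"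
        using more V W by auto
      then obtain U where "U \<in> \<pi>" "U \<noteq> V" "U \<noteq> W"
        using V False by auto
      then have "U \<inter> V = {}" "U \<inter> W = {}"
        using disjointD[OF partition_onD2[OF part]] V W by blast+
      with partition_on_blocks(2,3)[OF part fin \<open>U \<in> \<pi>\<close>] have "T \<noteq> {}"
        unfolding T_def by blast
      have smaller: "card (\<pi> - {X}) < card \<pi>" if "X \<in> \<pi>" for X
        using that \<open>finite \<pi>\<close> by (intro card_Diff1_less)
      have VT: "\<forall>i\<in>V. \<forall>k\<in>V. \<forall>j\<in>T. \<not> (i < j \<and> j < k)" and WT: "\<forall>i\<in>W. \<forall>k\<in>W. \<forall>j\<in>T. \<not> (i < j \<and> j < k)"
        using less.prems(3) int_W unfolding interval_block_def S T_def by blast+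
      have "T \<inter> V = {}" "T \<inter> W = {}" "finite T"
        using fin by (auto simp: T_def)
      let ?aV = "absorb (T \<union> W) V (\<phi> (ordered_prod a V)) a"
      let ?aW = "absorb (T \<union> V) W (\<phi> (ordered_prod a W)) a"
      have "phi_hat \<phi> (\<pi> - {W}) ?aW = phi_hat \<phi> (\<pi> - {W} - {V}) (absorb T V (\<phi> (ordered_prod ?aW V)) ?aW)"
        using less.hyps[OF smaller[OF W] partition_on_remove[OF part W] _
            interval_block_remove[OF less.prems(3) False] ne(1), of ?aW] fin blocks
        by (simp only: T finite_Diff finite_Un \<open>finite T\<close> simp_thms)
      also have "\<pi> - {W} - {V} = \<pi> - {V} - {W}"
        by blast
      also have "phi_hat \<phi> (\<pi> - {V} - {W}) (absorb T V (\<phi> (ordered_prod ?aW V)) ?aW) =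
          phi_hat \<phi> (\<pi> - {V} - {W}) (absorb T W (\<phi> (ordered_prod ?aV W)) ?aV)"
      proof (rule phi_hat_cong)
        fix i
        assume "i \<in> \<Union>(\<pi> - {V} - {W})"
        then have "i \<in> T"
          using disjointD[OF partition_onD2[OF part]] V W unfolding T_def S[symmetric] by blast
        from ord show "absorb T V (\<phi> (ordered_prod ?aW V)) ?aW i = absorb T W (\<phi> (ordered_prod ?aV W)) ?aV i"
        proof
          assume "\<forall>v\<in>V. \<forall>w\<in>W. v < w"
          then show ?thesis
            using absorb_absorb[of T V W i a] \<open>T \<noteq> {}\<close> \<open>T \<inter> V = {}\<close> \<open>T \<inter> W = {}\<close> \<open>finite T\<close> blocks VT \<open>i \<in> T\<close>
            by auto
        next
          assume "\<forall>w\<in>W. \<forall>v\<in>V. w < v"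
          then show ?thesis
            using absorb_absorb[of T W V i a] \<open>T \<noteq> {}\<close> \<open>T \<inter> V = {}\<close> \<open>T \<inter> W = {}\<close> \<open>finite T\<close> blocks WT \<open>i \<in> T\<close>
            by auto
        qed
      qed
      also have "phi_hat \<phi> (\<pi> - {V} - {W}) (absorb T W (\<phi> (ordered_prod ?aV W)) ?aV) = phi_hat \<phi> (\<pi> - {V}) ?aV"
        using less.hyps[OF smaller[OF V] partition_on_remove[OF part V] _
            interval_block_remove[OF int_W, of V] ne(2), of ?aV] False fin blocks
        by (simp only: T finite_Diff finite_Un \<open>finite T\<close> simp_thms)
      finally show ?thesis
        by (simp add: phi_hat T)
    qed
  qed
qed

text \<open>This carries differences produced by centring through the rest of a partition. For
  \<open>x = y = 0\<close> it says that a zero argument gives the value 0.\<close>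

lemma phi_hat_diff:
  assumes "partition_on S \<pi>" "finite S" "l \<in> S"
  shows "phi_hat \<phi> \<pi> (a(l := x - y)) = phi_hat \<phi> \<pi> (a(l := x)) - phi_hat \<phi> \<pi> (a(l := y))"
  using assms
proof (induction "card \<pi>" arbitrary: \<pi> S l x y a rule: less_induct)
  case less
  note part = less.prems(1) and fin = less.prems(2)
  have S: "\<Union>\<pi> = S"
    using part by (simp add: partition_on_def)
  have prod: "\<phi> (ordered_prod (a(k := x - y)) V) = \<phi> (ordered_prod (a(k := x)) V) - \<phi> (ordered_prod (a(k := y)) V)"
    if "finite V" "k \<in> V" for k V x y and a :: "nat \<Rightarrow> 'a"
    unfolding ordered_prod_upd[OF that] by (simp add: phi_diff algebra_simps)
  show ?case
  proof (cases "card \<pi> > 1 \<and> (\<exists>V. interval_block \<pi> V)")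
    case True
    then obtain V where V: "interval_block \<pi> V"
      by auto
    then have "V \<in> \<pi>"
      by (simp add: interval_block_def)
    have "\<pi> \<noteq> {V}"
      using True by auto
    note step = phi_hat_interval_block[OF part fin V this]
    have part': "partition_on (S - V) (\<pi> - {V})" and fin': "finite (S - V)"
      using partition_on_remove[OF part \<open>V \<in> \<pi>\<close>] fin by auto
    have "\<pi> - {V} \<noteq> {}"
      using \<open>\<pi> \<noteq> {V}\<close> \<open>V \<in> \<pi>\<close> by auto
    then obtain U where "U \<in> \<pi> - {V}"
      by blast
    with partition_on_blocks[OF part' fin' this] have "S - V \<noteq> {}"
      by blast
    have card: "card (\<pi> - {V}) < card \<pi>"
      using True \<open>V \<in> \<pi>\<close> card_ge_0_finite[of \<pi>] by (intro card_Diff1_less) auto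
    note IH = less.hyps[OF card part' fin']
    have finV: "finite V"
      using partition_on_blocks[OF part fin \<open>V \<in> \<pi>\<close>] by simp
    show ?thesis
    proof (cases "l \<in> V")
      case True
      \<comment> \<open>Once \<open>V\<close> is removed, a change of an argument inside
        \<open>V\<close> is felt only through the expectation \<open>\<beta>\<close>, which is
        linear in it and enters the argument at the absorbing index \<open>k\<close>.\<close>
      have eq: "phi_hat \<phi> (\<pi> - {V}) (absorb (S - V) V \<beta> (a(l := z))) =
          phi_hat \<phi> (\<pi> - {V}) (absorb (S - V) V \<beta> a)" for \<beta> z
        using True part' by (intro phi_hat_cong absorb_cong) (auto simp: partition_on_def)
      from fin' \<open>S - V \<noteq> {}\<close> show ?thesis
        unfolding step eq prod[OF finV True]
      proof (cases rule: absorb_cases[of "S - V" V])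
        case (1 k)
        then show "phi_hat \<phi> (\<pi> - {V}) (absorb (S - V) V (\<phi> (ordered_prod (a(l := x)) V) - \<phi> (ordered_prod (a(l := y)) V)) a) =
          phi_hat \<phi> (\<pi> - {V}) (absorb (S - V) V (\<phi> (ordered_prod (a(l := x)) V)) a) -
          phi_hat \<phi> (\<pi> - {V}) (absorb (S - V) V (\<phi> (ordered_prod (a(l := y)) V)) a)"
          by (simp add: IH right_diff_distrib)
      next
        case (2 k)
        then show "phi_hat \<phi> (\<pi> - {V}) (absorb (S - V) V (\<phi> (ordered_prod (a(l := x)) V) - \<phi> (ordered_prod (a(l := y)) V)) a) =
          phi_hat \<phi> (\<pi> - {V}) (absorb (S - V) V (\<phi> (ordered_prod (a(l := x)) V)) a) -
          phi_hat \<phi> (\<pi> - {V}) (absorb (S - V) V (\<phi> (ordered_prod (a(l := y)) V)) a)"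
          by (simp add: IH left_diff_distrib)
      qed
    next
      case False
      then have l: "l \<in> S - V"
        using less.prems by auto
      define \<beta> where "\<beta> = \<phi> (ordered_prod a V)"
      have \<beta>: "\<phi> (ordered_prod (a(l := z)) V) = \<beta>" for z
        using False by (simp add: ordered_prod_upd_outside \<beta>_def)
      from fin' \<open>S - V \<noteq> {}\<close> show ?thesis
        unfolding step \<beta>
      proof (cases rule: absorb_cases[of "S - V" V])
        case (1 k)
        show "phi_hat \<phi> (\<pi> - {V}) (absorb (S - V) V \<beta> (a(l := x - y))) =
          phi_hat \<phi> (\<pi> - {V}) (absorb (S - V) V \<beta> (a(l := x))) - phi_hat \<phi> (\<pi> - {V}) (absorb (S - V) V \<beta> (a(l := y)))"
        proof (cases "k = l")
          case False
          then show ?thesis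
            using IH[OF l, of "a(k := a k * \<beta>)" x y] by (simp add: 1 fun_upd_twist)
        qed (use IH l in \<open>simp add: 1 left_diff_distrib\<close>)
      next
        case (2 k)
        show "phi_hat \<phi> (\<pi> - {V}) (absorb (S - V) V \<beta> (a(l := x - y))) =
          phi_hat \<phi> (\<pi> - {V}) (absorb (S - V) V \<beta> (a(l := x))) - phi_hat \<phi> (\<pi> - {V}) (absorb (S - V) V \<beta> (a(l := y)))"
        proof (cases "k = l")
          case False
          then show ?thesis
            using IH[OF l, of "a(k := \<beta> * a k)" x y] by (simp add: 2 fun_upd_twist)
        qed (use IH l in \<open>simp add: 2 right_diff_distrib\<close>)
      qed
    qed
  next
    case False
    have "phi_hat \<phi> \<pi> b = \<phi> (ordered_prod b S)" for b
      unfolding phi_hat.simps[of _ \<pi> b] if_not_P[OF False] S ..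
    then show ?thesis
      using prod[OF fin less.prems(3)] by simp
  qed
qed

end

section \<open>Centring runs inside partitioned moments\<close>


lemma partition_on_disjointD:
  "partition_on S \<pi> \<Longrightarrow> V \<in> \<pi> \<Longrightarrow> W \<in> \<pi> \<Longrightarrow> V \<noteq> W \<Longrightarrow> V \<inter> W = {}"
  using disjointD[OF partition_onD2] by blast

lemma interval_blockI:
  "V \<in> \<pi> \<Longrightarrow> (\<And>i j k. i \<in> V \<Longrightarrow> k \<in> V \<Longrightarrow> j \<in> \<Union>\<pi> \<Longrightarrow> i < j \<Longrightarrow> j < k \<Longrightarrow> j \<in> V) \<Longrightarrow> interval_block \<pi> V"
  unfolding interval_block_def by blast

lemma interval_blockD:
  "interval_block \<pi> V \<Longrightarrow> i \<in> V \<Longrightarrow> k \<in> V \<Longrightarrow> j \<in> \<Union>\<pi> \<Longrightarrow> i < j \<Longrightarrow> j < k \<Longrightarrow> j \<in> V"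
  unfolding interval_block_def by blast

lemma interval_block_mem: "interval_block \<pi> V \<Longrightarrow> V \<in> \<pi>"
  unfolding interval_block_def by blast

definition split_block :: "nat set \<Rightarrow> nat set \<Rightarrow> nat set set \<Rightarrow> nat set set" where
  "split_block V I \<sigma> = insert I (insert (V - I) (\<sigma> - {V}))"

lemma Union_split_block: "V \<in> \<sigma> \<Longrightarrow> I \<subseteq> V \<Longrightarrow> \<Union>(split_block V I \<sigma>) = \<Union>\<sigma>"
  unfolding split_block_def by blast

lemma partition_on_split_block:
  assumes "partition_on S \<sigma>" "V \<in> \<sigma>" "I \<subseteq> V" "I \<noteq> {}" "V - I \<noteq> {}"
  shows "partition_on S (split_block V I \<sigma>)"
proof (rule partition_onI)
  show "\<Union>(split_block V I \<sigma>) = S"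
    using Union_split_block[OF assms(2,3)] assms(1) by (simp add: partition_on_def)
  show "{} \<notin> split_block V I \<sigma>"
    using assms partition_onD3[OF assms(1)] unfolding split_block_def by blast
  fix p q assume pq: "p \<in> split_block V I \<sigma>" "q \<in> split_block V I \<sigma>" "p \<noteq> q"
  have V: "p \<inter> V = {}" if "p \<in> \<sigma> - {V}" for p
    using partition_on_disjointD[OF assms(1)] that assms(2) by blast
  have "p \<inter> q = {}" if "p \<in> \<sigma> - {V}" "q \<in> \<sigma> - {V}"
    using partition_on_disjointD[OF assms(1), of p q] that pq(3) by blast
  then show "disjnt p q"
    using pq V[of p] V[of q] assms(3) unfolding split_block_def disjnt_def by blast
qed

lemma interval_block_split_block:
  "interval_block \<sigma> W \<Longrightarrow> W \<noteq> V \<Longrightarrow> V \<in> \<sigma> \<Longrightarrow> I \<subseteq> V \<Longrightarrow> interval_block (split_block V I \<sigma>) W"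
proof (rule interval_blockI)
  assume W: "interval_block \<sigma> W" "W \<noteq> V" "V \<in> \<sigma>" "I \<subseteq> V"
  show "W \<in> split_block V I \<sigma>"
    using interval_block_mem[OF W(1)] W(2) unfolding split_block_def by blast
  show "j \<in> W" if "i \<in> W" "k \<in> W" "j \<in> \<Union>(split_block V I \<sigma>)" "i < j" "j < k" for i j k
    using interval_blockD[OF W(1) that(1,2) _ that(4,5)] that(3) Union_split_block[OF W(3,4)] by blast
qed

text \<open>A block of least spread \<open>Max V - Min V\<close> is an interval: a block with a
  point in one of its gaps would, by noncrossing, lie strictly inside that spread.\<close>

lemma interval_block_exists:
  assumes "partition_on S \<pi>" "finite S" "S \<noteq> {}" "noncrossing \<pi>"
  shows "\<exists>V. interval_block \<pi> V"
proof -
  have S: "\<Union>\<pi> = S"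
    using assms(1) by (simp add: partition_on_def)
  then have "\<exists>V. V \<in> \<pi>"
    using assms(3) by blast
  then obtain V where V: "V \<in> \<pi>" and min: "\<And>U. U \<in> \<pi> \<Longrightarrow> Max V - Min V \<le> Max U - Min U"
    using ex_has_least_nat[of "\<lambda>V. V \<in> \<pi>" _ "\<lambda>V. Max V - Min V"] by blast
  have "j \<in> V" if "i \<in> V" "k \<in> V" "j \<in> S" "i < j" "j < k" for i j k
  proof (rule ccontr)
    assume "j \<notin> V"
    from \<open>j \<in> S\<close> obtain U where U: "U \<in> \<pi>" "j \<in> U"
      using S by blast
    then have "V \<noteq> U"
      using \<open>j \<notin> V\<close> by blast
    have "i < u \<and> u < k" if "u \<in> U" for u
    proof -
      have "u \<noteq> i" "u \<noteq> k"
        using partition_on_disjointD[OF assms(1) V U(1) \<open>V \<noteq> U\<close>] that \<open>i \<in> V\<close> \<open>k \<in> V\<close> by blast+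
      moreover have "\<not> u < i"
        using assms(4) V U \<open>V \<noteq> U\<close> that \<open>i \<in> V\<close> \<open>k \<in> V\<close> \<open>i < j\<close> \<open>j < k\<close> unfolding noncrossing_def by metis
      moreover have "\<not> k < u"
        using assms(4) V U \<open>V \<noteq> U\<close> that \<open>i \<in> V\<close> \<open>k \<in> V\<close> \<open>i < j\<close> \<open>j < k\<close> unfolding noncrossing_def by metis
      ultimately show ?thesis by linarith
    qed
    moreover have fin: "finite U" "U \<noteq> {}" "finite V"
      using partition_on_blocks[OF assms(1,2)] U(1) V by blast+
    ultimately have "i < Min U" "Max U < k"
      by auto
    moreover have "Min V \<le> i" "k \<le> Max V" "Min U \<le> Max U"
      using fin \<open>i \<in> V\<close> \<open>k \<in> V\<close> by auto
    ultimately have "Max U - Min U < Max V - Min V"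
      by linarith
    then show False
      using min[OF U(1)] by simp
  qed
  then show ?thesis
    using V by (auto simp: interval_block_def S)
qed

section \<open>Consecutive pieces of a block and their centring\<close>

definition increasing :: "nat set list \<Rightarrow> bool" where
  "increasing Vs \<longleftrightarrow> (\<forall>X\<in>set Vs. finite X \<and> X \<noteq> {}) \<and> sorted_wrt (\<lambda>X Y. \<forall>x\<in>X. \<forall>y\<in>Y. x < y) Vs"

text \<open>These are the two terms in the recursion of \<open>centered\<close>: the next piece
  joins the uncentred first one, or it is split off.\<close>

lemma increasing_merge: "increasing (X # Y # Vs) \<Longrightarrow> increasing ((X \<union> Y) # Vs)"
  and increasing_drop: "increasing (X # Y # Vs) \<Longrightarrow> increasing (X # Vs)"
  unfolding increasing_def by auto

lemma increasing_diff:
  assumes "increasing (X # Y # Vs)"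
  shows "(X \<union> \<Union>(set (Y # Vs))) - Y = X \<union> \<Union>(set Vs)"
proof -
  have "x \<notin> Y" if "x \<in> X \<or> x \<in> \<Union>(set Vs)" for x
    using assms that unfolding increasing_def by fastforce
  then show ?thesis by auto
qed

lemma increasing_convex:
  assumes "increasing (X # Y # Vs)" "x \<in> Y" "z \<in> Y" "x < y" "y < z" "y \<in> X \<union> \<Union>(set (Y # Vs))"
  shows "y \<in> Y"
proof -
  have "\<not> y < x" "\<not> z < y"
    using assms(4,5) by simp_all
  then have "y \<notin> X" "y \<notin> \<Union>(set Vs)"
    using assms(1-3) unfolding increasing_def by auto
  then show ?thesis
    using assms(6) by auto
qed

context nc_prob_space
begin

text \<open>The partitioned moment of \<open>\<sigma>\<close> in which the subproducts over the members of \<open>Is\<close>, consecutive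
  pieces of the block \<open>V\<close>, are centred, expanded into partitioned moments.\<close>

primrec centered :: "nat set list \<Rightarrow> nat set set \<Rightarrow> nat set \<Rightarrow> (nat \<Rightarrow> 'a) \<Rightarrow> 'a" where
  "centered [] \<sigma> V a = phi_hat \<phi> \<sigma> a"
| "centered (I # Is) \<sigma> V a = centered Is \<sigma> V a - centered Is (split_block V I \<sigma>) (V - I) a"

text \<open>The terms of the expansion differ only in how \<open>V\<close> is cut up. So an interval
  block \<open>W\<close> elsewhere can be removed from all of them at once, and the same index
  absorbs its expectation each time.\<close>

lemma centered_remove:
  assumes "increasing (V1 # Is)" "V = V1 \<union> \<Union>(set Is)" "partition_on S \<sigma>" "finite S" "V \<in> \<sigma>"
    "interval_block \<sigma> W" "W \<noteq> V"
  shows "centered Is \<sigma> V a = centered Is (\<sigma> - {W}) V (absorb (S - W) W (\<phi> (ordered_prod a W)) a)"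
  using assms
proof (induction Is arbitrary: V1 V \<sigma>)
  case Nil
  then have "\<sigma> \<noteq> {W}" by auto
  then show ?case
    using phi_hat_interval_block[of S \<sigma> W a] Nil by simp
next
  case (Cons I Is)
  note V = Cons.prems(2) and part = Cons.prems(3)
  have I: "I \<subseteq> V" "I \<noteq> {}" "V - I = V1 \<union> \<Union>(set Is)" "V - I \<noteq> {}"
    using Cons.prems(1) increasing_diff[OF Cons.prems(1)] V by (auto simp: increasing_def)
  have W: "W \<in> \<sigma>"
    using Cons.prems(6) by (simp add: interval_block_def)
  have "W \<inter> V = {}" "W \<noteq> {}"
    using partition_on_disjointD[OF part W Cons.prems(5,7)] partition_on_blocks[OF part Cons.prems(4) W] by blast+
  then have neq: "W \<noteq> I" "W \<noteq> V - I"
    using I by auto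
  have "centered Is \<sigma> V a = centered Is (\<sigma> - {W}) V (absorb (S - W) W (\<phi> (ordered_prod a W)) a)"
    using Cons.prems increasing_merge[OF Cons.prems(1)] by (intro Cons.IH[of "V1 \<union> I"]) auto
  moreover have "centered Is (split_block V I \<sigma>) (V - I) a =
      centered Is (split_block V I \<sigma> - {W}) (V - I) (absorb (S - W) W (\<phi> (ordered_prod a W)) a)"
  proof (rule Cons.IH[OF increasing_drop[OF Cons.prems(1)] I(3)])
    show "partition_on S (split_block V I \<sigma>)"
      using part Cons.prems(5) I(1,2,4) by (rule partition_on_split_block)
    show "interval_block (split_block V I \<sigma>) W"
      using Cons.prems(6,7,5) I(1) by (rule interval_block_split_block)
    show "V - I \<in> split_block V I \<sigma>"
      by (simp add: split_block_def)
  qed (use Cons.prems neq in auto)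
  moreover have "split_block V I (\<sigma> - {W}) = split_block V I \<sigma> - {W}"
    using neq by (auto simp: split_block_def)
  ultimately show ?case
    by simp
qed

text \<open>A piece \<open>I\<close> split off is an interval whose expectation is absorbed by the
  last index of \<open>V1\<close>, just to its left in the product. The two terms of the recursion
  thus arise from distributing the factor
  \<open>ordered_prod a I - \<phi> (ordered_prod a I)\<close>.\<close>

lemma centered_single:
  assumes "increasing (V1 # Is)" "V = V1 \<union> \<Union>(set Is)"
  shows "centered Is {V} V a =
    \<phi> (ordered_prod a V1 * prod_list (map (\<lambda>I. ordered_prod a I - \<phi> (ordered_prod a I)) Is))"
  using assms
proof (induction Is arbitrary: V1 V a)
  case Nil
  then show ?case by (simp add: phi_hat_single)
next
  case (Cons I Is)
  define \<beta> where "\<beta> = \<phi> (ordered_prod a I)"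
  define P where "P = prod_list (map (\<lambda>I. ordered_prod a I - \<phi> (ordered_prod a I)) Is)"
  define l where "l = Max V1"
  have I: "I \<subseteq> V" "I \<noteq> {}" "V - I = V1 \<union> \<Union>(set Is)" "V - I \<noteq> {}"
    using Cons.prems(1) increasing_diff[OF Cons.prems(1)] Cons.prems(2) by (auto simp: increasing_def)
  have fin: "finite V" "finite V1" "finite I" and l: "l \<in> V1" "\<And>i. i \<in> V1 \<Longrightarrow> i \<le> l"
    using Cons.prems by (auto simp: increasing_def l_def)
  have l_less: "l < Min I" "l \<notin> I" "l \<notin> X" "Min I < x" if "X \<in> set Is" "x \<in> X" for x X
    using Cons.prems(1) l that fin by (fastforce simp: increasing_def)+
  have l_less': "l < Min I"
    using Cons.prems(1) l fin by (auto simp: increasing_def)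
  have split: "split_block V I {V} = {I, V - I}" "{I, V - I} - {I} = {V - I}"
    using I by (auto simp: split_block_def)
  have part: "partition_on V {I, V - I}"
    using partition_on_split_block[of V "{V}" V I] I partition_on_space[of V] split by auto
  have "x < y \<Longrightarrow> y < z \<Longrightarrow> x \<in> I \<Longrightarrow> z \<in> I \<Longrightarrow> y \<in> V \<Longrightarrow> y \<in> I" for x y z
    using increasing_convex[OF Cons.prems(1), of x z y] Cons.prems(2) by blast
  then have int: "interval_block {I, V - I} I"
    using I(1) by (intro interval_blockI) blast+
  have absorb: "absorb (V - I) I \<beta> a = a(l := a l * \<beta>)"
  proof (rule absorb_left)
    show "i \<le> l" if "i \<in> V - I" "i < Min I" for i
      using that l(2)[of i] l_less(4)[of _ i] unfolding I(3) by (auto dest: less_asym)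
    show "finite (V - I)" "l < Min I"
      using fin l_less' by simp_all
    show "l \<in> V - I"
      unfolding I(3) using l by simp
  qed
  have "centered Is (split_block V I {V}) (V - I) a = centered Is {V - I} (V - I) (a(l := a l * \<beta>))"
    using centered_remove[OF increasing_drop[OF Cons.prems(1)] I(3) part fin(1) _ int, of a] I(1,2)
    unfolding split absorb \<beta>_def[symmetric] by blast
  also have "\<dots> = \<phi> (ordered_prod (a(l := a l * \<beta>)) V1 *
      prod_list (map (\<lambda>I. ordered_prod (a(l := a l * \<beta>)) I - \<phi> (ordered_prod (a(l := a l * \<beta>)) I)) Is))"
    by (rule Cons.IH[OF increasing_drop[OF Cons.prems(1)] I(3)])
  also have "map (\<lambda>I. ordered_prod (a(l := a l * \<beta>)) I - \<phi> (ordered_prod (a(l := a l * \<beta>)) I)) Is =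
      map (\<lambda>I. ordered_prod a I - \<phi> (ordered_prod a I)) Is"
    using l_less(3) by (intro map_cong refl) (metis ordered_prod_upd_outside)
  also have "ordered_prod (a(l := a l * \<beta>)) V1 = ordered_prod a V1 * \<beta>"
    using fin l by (intro ordered_prod_upd_right)
  finally have "centered Is (split_block V I {V}) (V - I) a = \<phi> (ordered_prod a V1 * \<beta> * P)"
    by (simp add: P_def)
  moreover have "centered Is {V} V a = \<phi> (ordered_prod a (V1 \<union> I) * P)"
    unfolding P_def using Cons.prems(2) by (intro Cons.IH increasing_merge[OF Cons.prems(1)]) auto
  moreover have "ordered_prod a (V1 \<union> I) = ordered_prod a V1 * ordered_prod a I"
    using fin Cons.prems(1) by (intro ordered_prod_Un) (auto simp: increasing_def)
  ultimately show ?case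
    by (simp add: phi_diff[symmetric] P_def[symmetric] \<beta>_def[symmetric] algebra_simps)
qed

text \<open>The pieces of an interval block can be removed before all other blocks, each being
  absorbed inside \<open>V\<close>. By additivity the whole expansion then takes place within the
  one argument that absorbs the value of \<open>V\<close>.\<close>

lemma centered_interval:
  assumes "increasing (V1 # Is)" "V = V1 \<union> \<Union>(set Is)" "partition_on S \<sigma>" "finite S" "interval_block \<sigma> V"
    "\<sigma> \<noteq> {V}"
  shows "centered Is \<sigma> V a = phi_hat \<phi> (\<sigma> - {V}) (absorb (S - V) V (centered Is {V} V a) a)"
  using assms
proof (induction Is arbitrary: V1 V \<sigma> S a)
  case Nil
  then show ?case
    using phi_hat_interval_block[of S \<sigma> V a] by (simp add: phi_hat_single)
next
  case (Cons I Is)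
  note part = Cons.prems(3) and finS = Cons.prems(4) and int_V = Cons.prems(5)
  have V: "V \<in> \<sigma>" and S: "\<Union>\<sigma> = S"
    using int_V part by (auto simp: interval_block_def partition_on_def)
  define \<beta> where "\<beta> = \<phi> (ordered_prod a I)"
  define l where "l = Max V1"
  have I: "I \<subseteq> V" "I \<noteq> {}" "V - I = V1 \<union> \<Union>(set Is)" "V - I \<noteq> {}"
    using Cons.prems(1) increasing_diff[OF Cons.prems(1)] Cons.prems(2) by (auto simp: increasing_def)
  have fin: "finite V" "finite V1" "finite I" and l: "l \<in> V1" "\<And>i. i \<in> V1 \<Longrightarrow> i \<le> l"
    using Cons.prems by (auto simp: increasing_def l_def)
  have l_less: "Min I < x" if "X \<in> set Is" "x \<in> X" for x X
    using Cons.prems(1) l that fin by (fastforce simp: increasing_def)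
  have l_less': "l < Min I" "Min I \<in> I"
    using Cons.prems(1) l fin by (auto simp: increasing_def)
  let ?a = "a(l := a l * \<beta>)"
  let ?\<sigma> = "split_block V I \<sigma>" and ?\<tau> = "insert (V - I) (\<sigma> - {V})"
  have V_S: "V \<subseteq> S" and disj: "\<And>U. U \<in> \<sigma> \<Longrightarrow> U \<noteq> V \<Longrightarrow> U \<inter> V = {}"
    using S V partition_on_disjointD[OF part] by blast+
  have notin: "I \<notin> \<sigma> - {V}" "V - I \<notin> \<sigma> - {V}"
    using disj I by blast+
  have split: "split_block V I {V} = {I, V - I}" "{I, V - I} - {I} = {V - I}" "?\<sigma> - {I} = ?\<tau>"
    using I notin unfolding split_block_def by blast+
  have partI: "partition_on V {I, V - I}"
    using partition_on_split_block[of V "{V}" V I] I partition_on_space[of V] split by auto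
  have part\<sigma>: "partition_on S ?\<sigma>"
    using partition_on_split_block[OF part V] I by auto
  have "x < y \<Longrightarrow> y < z \<Longrightarrow> x \<in> I \<Longrightarrow> z \<in> I \<Longrightarrow> y \<in> V \<Longrightarrow> y \<in> I" for x y z
    using increasing_convex[OF Cons.prems(1), of x z y] Cons.prems(2) by blast
  moreover have V_conv: "x < y \<Longrightarrow> y < z \<Longrightarrow> x \<in> V \<Longrightarrow> z \<in> V \<Longrightarrow> y \<in> S \<Longrightarrow> y \<in> V" for x y z
    using interval_blockD[OF int_V, of x z y] S by blast
  ultimately have I_conv: "x < y \<Longrightarrow> y < z \<Longrightarrow> x \<in> I \<Longrightarrow> z \<in> I \<Longrightarrow> y \<in> S \<Longrightarrow> y \<in> I" for x y z
    using I(1) by blast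
  have int: "interval_block {I, V - I} I" "interval_block ?\<sigma> I"
    subgoal using I_conv I(1) V_S by (intro interval_blockI) blast+
    subgoal using I_conv Union_split_block[OF V I(1)] S
      by (intro interval_blockI) (simp_all add: split_block_def)
    done
  have absorb: "absorb T I \<beta> a = ?a" if "finite T" "l \<in> T" "T \<subseteq> S - I" for T
  proof (rule absorb_left)
    show "i \<le> l" if "i \<in> T" "i < Min I" for i
    proof (cases "i \<in> V")
      case True
      then have "i \<in> V1 \<union> \<Union>(set Is)"
        using that \<open>T \<subseteq> S - I\<close> I(3) by blast
      then show ?thesis
        using that l(2)[of i] l_less[of _ i] by (auto dest: less_asym)
    next
      case False
      then show ?thesis
        using V_conv[of l i "Min I"] that l l_less' I \<open>T \<subseteq> S - I\<close> by (metis Cons.prems(2) DiffD1 UnI1 linorder_le_less_linear subsetD)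
    qed
  qed (use that l_less' in auto)
  have "l \<in> V - I"
    using I(3) l by auto
  have tau: "partition_on (S - I) ?\<tau>" "interval_block ?\<tau> (V - I)" "?\<tau> \<noteq> {V - I}"
      "?\<tau> - {V - I} = \<sigma> - {V}"
  proof -
    show "partition_on (S - I) ?\<tau>"
      using partition_on_remove[OF part\<sigma>, of I] split by (auto simp: split_block_def)
    then have "\<Union>?\<tau> = S - I"
      by (simp add: partition_on_def)
    then show "interval_block ?\<tau> (V - I)"
      using V_conv by (intro interval_blockI) blast+
    show "?\<tau> \<noteq> {V - I}" "?\<tau> - {V - I} = \<sigma> - {V}"
      using notin V Cons.prems(6) by auto
  qed
  have "centered Is ?\<sigma> (V - I) a = centered Is ?\<tau> (V - I) ?a"
  proof -
    have "V - I \<in> ?\<sigma>" "I \<noteq> V - I" "l \<in> S - I"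
      using I(1,2) V_S \<open>l \<in> V - I\<close> by (auto simp: split_block_def)
    note centered_remove[OF increasing_drop[OF Cons.prems(1)] I(3) part\<sigma> finS this(1) int(2) this(2), of a]
      and absorb[OF finite_Diff[OF finS] this(3) order.refl]
    then show ?thesis
      unfolding \<beta>_def[symmetric] split by (simp only:)
  qed
  also have "\<dots> = phi_hat \<phi> (\<sigma> - {V}) (absorb (S - I - (V - I)) (V - I) (centered Is {V - I} (V - I) ?a) ?a)"
    using Cons.IH[OF increasing_drop[OF Cons.prems(1)] I(3) tau(1) _ tau(2,3)] finS tau(4) by auto
  also have "S - I - (V - I) = S - V"
    using I by auto
  also have "centered Is {V - I} (V - I) ?a = centered Is {I, V - I} (V - I) a"
    using centered_remove[OF increasing_drop[OF Cons.prems(1)] I(3) partI fin(1) _ int(1), of a] I(1,2)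
      absorb[OF finite_Diff[OF fin(1)] \<open>l \<in> V - I\<close> Diff_mono[OF V_S order.refl]]
    unfolding \<beta>_def[symmetric] split by fastforce
  \<comment> \<open>The update at \<open>l\<close> concerns an index of \<open>V\<close>, which is
    gone. Since \<open>V1\<close> precedes \<open>I\<close>, the sets \<open>V - I\<close> and
    \<open>V\<close> have the same minimum, so the same index absorbs.\<close>
  also have "phi_hat \<phi> (\<sigma> - {V}) (absorb (S - V) (V - I) \<gamma> ?a) = phi_hat \<phi> (\<sigma> - {V}) (absorb (S - V) V \<gamma> a)" for \<gamma>
  proof (rule phi_hat_cong)
    have "Min V \<le> l"
      using fin(1) \<open>l \<in> V - I\<close> by simp
    then have "Min V \<notin> I"
      using l_less'(1) fin(3) by (metis Min_le not_less order.trans)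
    then have "Min V \<in> V - I"
      using fin(1) \<open>l \<in> V - I\<close> Min_in[of V] by blast
    then have "Min (V - I) = Min V"
      using fin by (intro Min_eqI) auto
    then have "absorb (S - V) (V - I) \<gamma> ?a = absorb (S - V) V \<gamma> ?a"
      by (simp add: absorb_def)
    moreover fix i assume "i \<in> \<Union>(\<sigma> - {V})"
    then have "i \<noteq> l"
      using disj \<open>l \<in> V - I\<close> by blast
    then have "absorb (S - V) V \<gamma> ?a i = absorb (S - V) V \<gamma> a i"
      by (intro absorb_cong) auto
    ultimately show "absorb (S - V) (V - I) \<gamma> ?a i = absorb (S - V) V \<gamma> a i"
      by simp
  qed
  finally have *: "centered Is ?\<sigma> (V - I) a =
      phi_hat \<phi> (\<sigma> - {V}) (absorb (S - V) V (centered Is {I, V - I} (V - I) a) a)" .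
  have **: "centered Is \<sigma> V a = phi_hat \<phi> (\<sigma> - {V}) (absorb (S - V) V (centered Is {V} V a) a)"
    using Cons.prems increasing_merge[OF Cons.prems(1)] by (intro Cons.IH[of "V1 \<union> I"]) auto
  have part': "partition_on (S - V) (\<sigma> - {V})" "finite (S - V)"
    using partition_on_remove[OF part V] finS by auto
  obtain U where "U \<in> \<sigma> - {V}"
    using V Cons.prems(6) by blast
  with partition_on_blocks[OF part' this] have "S - V \<noteq> {}"
    by blast
  with part'(2) have diff: "phi_hat \<phi> (\<sigma> - {V}) (absorb (S - V) V (x - y) a) =
      phi_hat \<phi> (\<sigma> - {V}) (absorb (S - V) V x a) - phi_hat \<phi> (\<sigma> - {V}) (absorb (S - V) V y a)" for x y
  proof (cases rule: absorb_cases[of "S - V" V, case_names left right])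
    case (left k)
    then show ?thesis
      using phi_hat_diff[OF part', of k a] by (simp add: right_diff_distrib)
  next
    case (right k)
    then show ?thesis
      using phi_hat_diff[OF part', of k a] by (simp add: left_diff_distrib)
  qed
  show ?case
    by (simp add: * ** diff split)
qed

end

section \<open>Runs of a word and noncrossing partitions\<close>


lemma noncrossing_subset:
  assumes "noncrossing \<pi>" "\<pi>' \<subseteq> \<pi>"
  shows "noncrossing \<pi>'"
  unfolding noncrossing_def
proof (intro ballI impI)
  fix V W i j k l
  assume "V \<in> \<pi>'" "W \<in> \<pi>'" "i \<in> V" "j \<in> W" "k \<in> V" "l \<in> W" "i < j \<and> j < k \<and> k < l"
  then show "V = W"
    using assms(1)[unfolded noncrossing_def, rule_format, of V W i j k l] assms(2) by blast
qed

lemma hd_sorted_list_of_set: "finite X \<Longrightarrow> X \<noteq> {} \<Longrightarrow> hd (sorted_list_of_set X) = Min X"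
  by (simp add: sorted_list_of_set_nonempty)

lemma last_sorted_list_of_set:
  assumes "finite (X :: 'a :: linorder set)" "X \<noteq> {}"
  shows "last (sorted_list_of_set X) = Max X"
proof -
  have ne: "sorted_list_of_set X \<noteq> []"
    using assms by simp
  then have "sorted (butlast (sorted_list_of_set X) @ [last (sorted_list_of_set X)])"
    by simp
  then have "\<forall>x\<in>set (butlast (sorted_list_of_set X) @ [last (sorted_list_of_set X)]). x \<le> last (sorted_list_of_set X)"
    by (auto simp: sorted_append simp del: append_butlast_last_id)
  moreover have "last (sorted_list_of_set X) \<in> X"
    using last_in_set[OF ne] assms by simp
  ultimately show ?thesis
    using assms ne by (intro Max_eqI[symmetric]) auto
qed

section \<open>Alternating sets and products of centred runs\<close>

definition adjacent :: "nat set \<Rightarrow> nat \<Rightarrow> nat \<Rightarrow> bool" where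
  "adjacent X x y \<longleftrightarrow> x \<in> X \<and> y \<in> X \<and> x < y \<and> (\<forall>z\<in>X. \<not> (x < z \<and> z < y))"

definition alternating :: "(nat \<Rightarrow> bool) \<Rightarrow> nat set \<Rightarrow> bool" where
  "alternating w X \<longleftrightarrow> (\<forall>x y. adjacent X x y \<longrightarrow> w x \<noteq> w y)"

lemma distinct_adj_alternating:
  assumes "finite X" "alternating w X"
  shows "distinct_adj (map w (sorted_list_of_set X))"
  unfolding distinct_adj_conv_nth
proof (intro allI impI)
  fix i
  let ?xs = "sorted_list_of_set X"
  assume i: "Suc i < length (map w ?xs)"
  have set: "set ?xs = X" and less: "?xs ! j < ?xs ! k" if "j < k" "k < length ?xs" for j k
    using assms(1) that sorted_wrt_nth_less[OF strict_sorted_list_of_set, of j k X] by auto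
  have iff: "?xs ! j < ?xs ! k \<longleftrightarrow> j < k" if "j < length ?xs" "k < length ?xs" for j k
    using less[of j k] less[of k j] that by (metis less_asym less_irrefl linorder_neqE_nat)
  have "adjacent X (?xs ! i) (?xs ! Suc i)"
    unfolding adjacent_def
  proof (intro conjI ballI)
    show "?xs ! i \<in> X" "?xs ! Suc i \<in> X"
      using i assms(1) nth_mem[of i ?xs] nth_mem[of "Suc i" ?xs] by auto
    show "?xs ! i < ?xs ! Suc i"
      using i by (subst iff) auto
    fix z assume "z \<in> X"
    then obtain k where k: "k < length ?xs" "z = ?xs ! k"
      using assms(1) by (metis in_set_conv_nth set_sorted_list_of_set)
    then show "\<not> (?xs ! i < z \<and> z < ?xs ! Suc i)"
      using i iff[of i k] iff[of k "Suc i"] by auto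
  qed
  then show "map w ?xs ! i \<noteq> map w ?xs ! Suc i"
    using assms(2) i by (auto simp: alternating_def)
qed

lemma hd_eq_last_alternating_list:
  "bs \<noteq> [] \<Longrightarrow> distinct_adj (bs :: bool list) \<Longrightarrow> hd bs = last bs \<longleftrightarrow> odd (length bs)"
  by (induction bs rule: list_nonempty_induct) (auto simp: distinct_adj_Cons)

lemma Min_Max_alternating:
  assumes "finite X" "X \<noteq> {}" "alternating w X"
  shows "w (Min X) = w (Max X) \<longleftrightarrow> odd (card X)"
proof -
  have ne: "sorted_list_of_set X \<noteq> []"
    using assms by simp
  have "w (Min X) = hd (map w (sorted_list_of_set X))" "w (Max X) = last (map w (sorted_list_of_set X))"
    using ne assms(1,2) by (simp_all add: hd_map last_map hd_sorted_list_of_set last_sorted_list_of_set)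
  then show ?thesis
    using hd_eq_last_alternating_list[OF _ distinct_adj_alternating[OF assms(1,3)]] ne by simp
qed

text \<open>The last condition expresses that the runs are maximal.\<close>

definition run_decomposition :: "(nat \<Rightarrow> bool) \<Rightarrow> nat set list \<Rightarrow> bool" where
  "run_decomposition w Vs \<longleftrightarrow> increasing Vs \<and> (\<forall>X\<in>set Vs. alternating w X) \<and>
     successively (\<lambda>X Y. w (Max X) = w (Min Y)) Vs"

context free_even_pair
begin

text \<open>Write the first factor as its centred part plus its expectation. The first summand gives
  an alternating product. The second leaves the product of the remaining centred runs, or, if there
  are none, the expectation of a run with equal end letters; both vanish.\<close>

lemma phi_centered_runs:
  assumes runs: "run_decomposition w (V1 # Is)"
    and letter: "\<forall>X\<in>set (V1 # Is). \<forall>x\<in>X. a x \<in> letter (w x)"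
    and ne: "Is \<noteq> [] \<or> w (Min V1) = w (Max V1)"
  shows "\<phi> (ordered_prod a V1 * prod_list (map (\<lambda>I. ordered_prod a I - \<phi> (ordered_prod a I)) Is)) = 0"
proof -
  define y where "y = (\<lambda>X. ordered_prod a X - \<phi> (ordered_prod a X))"
  have run: "alt (\<not> w (Max X)) (w (Min X)) (y X)"
      "w (Min X) = w (Max X) \<Longrightarrow> \<phi> (ordered_prod a X) = 0" if "X \<in> set (V1 # Is)" for X
  proof -
    have X: "finite X" "X \<noteq> {}" "alternating w X" "\<forall>x\<in>X. a x \<in> letter (w x)"
      using runs letter that by (auto simp: run_decomposition_def increasing_def)
    then have "sorted_list_of_set X \<noteq> []" "\<forall>x\<in>set (sorted_list_of_set X). a x \<in> letter (w x)"
      by simp_all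
    note * = run_centered[OF this(1) distinct_adj_alternating[OF X(1,3)] this(2)]
    show "alt (\<not> w (Max X)) (w (Min X)) (y X)"
      "w (Min X) = w (Max X) \<Longrightarrow> \<phi> (ordered_prod a X) = 0"
      using * X by (simp_all add: hd_sorted_list_of_set last_sorted_list_of_set ordered_prod_def y_def)
  qed
  have runs_alt: "\<exists>j. alt j (w (Min (hd Js))) (prod_list (map y Js))"
    if "Js \<noteq> []" "set Js \<subseteq> set (V1 # Is)" "successively (\<lambda>X Y. w (Max X) = w (Min Y)) Js" for Js
    using that
  proof (induction Js rule: list_nonempty_induct)
    case (single X)
    then show ?case using run(1)[of X] by auto
  next
    case (cons X Js)
    then obtain j where "alt j (w (Min (hd Js))) (prod_list (map y Js))"
      by (auto simp: successively_Cons)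
    \<comment> \<open>\<open>y X\<close> ends in the algebra with index
      \<open>\<not> w (Max X)\<close>, so \<open>alt_mult\<close> requires the next run to start in
      that with index \<open>w (Max X)\<close>. Equal letters at the cut provide this.\<close>
    moreover have "w (Min (hd Js)) = (\<not> \<not> w (Max X))"
      using cons by (auto simp: successively_Cons)
    ultimately have "alt j (w (Min X)) (y X * prod_list (map y Js))"
      using run(1)[of X] cons.prems by (intro alt_mult) auto
    then show ?case by auto
  qed
  have "ordered_prod a V1 * prod_list (map y Is) =
      prod_list (map y (V1 # Is)) + \<phi> (ordered_prod a V1) * prod_list (map y Is)"
    by (simp add: y_def left_diff_distrib)
  moreover have "\<phi> (prod_list (map y (V1 # Is))) = 0"
    using runs_alt[of "V1 # Is"] runs phi_alt by (auto simp: run_decomposition_def)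
  moreover have "\<phi> (ordered_prod a V1) * \<phi> (prod_list (map y Is)) = 0"
  proof (cases "Is = []")
    case True
    then show ?thesis
      using run(2)[of V1] ne by auto
  next
    case False
    then have "\<phi> (prod_list (map y Is)) = 0"
      using runs_alt[of Is] runs phi_alt by (auto simp: run_decomposition_def successively_Cons)
    then show ?thesis by simp
  qed
  ultimately show ?thesis
    unfolding y_def[symmetric] by (simp add: phi_add phi_mult_left)
qed

text \<open>Interval blocks other than \<open>V\<close> are removed until \<open>V\<close> is itself
  an interval block or the only block left. Absorption multiplies by elements of \<open>B\<close>
  only, so the arguments on \<open>V\<close> remain letters and freeness applies at the end.\<close>

lemma centered_eq_0:
  assumes "partition_on S \<sigma>" "finite S" "noncrossing \<sigma>" "V \<in> \<sigma>" "V = V1 \<union> \<Union>(set Is)"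
    and "run_decomposition w (V1 # Is)" "\<forall>x\<in>V. a x \<in> letter (w x)"
    and "Is \<noteq> [] \<or> w (Min V1) = w (Max V1)"
  shows "centered Is \<sigma> V a = 0"
  using assms(1-4,7)
proof (induction "card \<sigma>" arbitrary: \<sigma> S a rule: less_induct)
  case less
  note part = less.prems(1) and finS = less.prems(2) and V = less.prems(4)
  have inc: "increasing (V1 # Is)"
    using assms(6) by (simp add: run_decomposition_def)
  have single: "centered Is {V} V a = 0"
    unfolding centered_single[OF inc assms(5)]
    using assms(5,6,8) less.prems(5) by (intro phi_centered_runs) auto
  consider "\<sigma> = {V}" | "\<sigma> \<noteq> {V}" "interval_block \<sigma> V" | W where "interval_block \<sigma> W" "W \<noteq> V"
    using interval_block_exists[OF part finS _ less.prems(3)] partition_on_blocks[OF part finS V] by blast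
  then show ?case
  proof cases
    case 1
    then show ?thesis using single by simp
  next
    case 2
    have part': "partition_on (S - V) (\<sigma> - {V})" "finite (S - V)"
      using partition_on_remove[OF part V] finS by auto
    obtain U where "U \<in> \<sigma> - {V}"
      using V 2 by blast
    with partition_on_blocks[OF part' this] have "S - V \<noteq> {}"
      by blast
    \<comment> \<open>The value 0 of \<open>V\<close> makes the absorbing argument 0;
      \<open>phi_hat_diff\<close> with both arguments 0 then gives the value 0.\<close>
    with part'(2) have "phi_hat \<phi> (\<sigma> - {V}) (absorb (S - V) V 0 a) = 0"
    proof (cases rule: absorb_cases[of "S - V" V, case_names left right])
      case (left k)
      then show ?thesis
        using phi_hat_diff[OF part', of k a 0 0] by simp
    next
      case (right k)
      then show ?thesis
        using phi_hat_diff[OF part', of k a 0 0] by simp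
    qed
    then show ?thesis
      using centered_interval[OF inc assms(5) part finS 2(2,1)] single by simp
  next
    case (3 W)
    have W: "W \<in> \<sigma>"
      using 3 interval_block_mem by blast
    let ?a = "absorb (S - W) W (\<phi> (ordered_prod a W)) a"
    have "?a x \<in> letter (w x)" if "x \<in> V" for x
      using that less.prems(5) unfolding absorb_def Let_def by (auto intro: letter_B_mult letter_mult_B)
    moreover have "noncrossing (\<sigma> - {W})"
      by (rule noncrossing_subset[OF less.prems(3)]) blast
    moreover have "card (\<sigma> - {W}) < card \<sigma>"
      using W partition_on_blocks(4)[OF part finS W] by (intro card_Diff1_less)
    ultimately have "centered Is (\<sigma> - {W}) V ?a = 0"
      using V finS partition_on_remove[OF part W] 3 by (intro less.hyps[of "\<sigma> - {W}" "S - W"]) auto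
    then show ?thesis
      using centered_remove[OF inc assms(5) part finS V 3] by simp
  qed
qed

end

text \<open>\<open>\<rho>\<close> numbers the maximal alternating runs of the word \<open>w\<close> on \<open>V\<close> from left to right.\<close>

definition run_index :: "(nat \<Rightarrow> bool) \<Rightarrow> nat set \<Rightarrow> (nat \<Rightarrow> nat) \<Rightarrow> bool" where
  "run_index w V \<rho> \<longleftrightarrow> mono_on V \<rho> \<and> (\<forall>x y. adjacent V x y \<longrightarrow> (\<rho> x = \<rho> y \<longleftrightarrow> w x \<noteq> w y))"

lemma run_index_exists: "finite V \<Longrightarrow> \<exists>\<rho>. run_index w V \<rho>"
proof (induction V rule: finite_linorder_max_induct)
  case empty
  then show ?case by (auto simp: run_index_def adjacent_def)
next
  case (insert v V)
  then obtain \<rho> where \<rho>: "run_index w V \<rho>"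
    by auto
  show ?case
  proof (cases "V = {}")
    case True
    then show ?thesis by (auto simp: run_index_def adjacent_def mono_on_def)
  next
    case False
    define m where "m = Max V"
    have m: "m \<in> V" "\<And>x. x \<in> V \<Longrightarrow> x \<le> m"
      using insert.hyps False by (auto simp: m_def)
    define \<rho>' where "\<rho>' = \<rho>(v := if w v \<noteq> w m then \<rho> m else Suc (\<rho> m))"
    have mono: "\<rho> x \<le> \<rho> y" if "x \<in> V" "y \<in> V" "x \<le> y" for x y
      using \<rho> that by (auto simp: run_index_def mono_on_def)
    have "mono_on (insert v V) \<rho>'"
    proof (rule mono_onI)
      fix x y assume xy: "x \<in> insert v V" "y \<in> insert v V" "x \<le> y"
      show "\<rho>' x \<le> \<rho>' y"
      proof (cases "y = v")
        case True
        then show ?thesis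
          using xy m mono[of x m] insert.hyps by (auto simp: \<rho>'_def)
      next
        case False
        then have "y \<in> V" "x \<in> V" "x \<noteq> v"
          using xy insert.hyps by auto
        then show ?thesis
          using False mono[of x y] xy by (auto simp: \<rho>'_def)
      qed
    qed
    moreover have "\<rho>' x = \<rho>' y \<longleftrightarrow> w x \<noteq> w y" if adj: "adjacent (insert v V) x y" for x y
    proof (cases "y = v")
      case True
      then have "x \<in> V" "\<not> x < m"
        using adj m insert.hyps(2) by (auto simp: adjacent_def)
      then have "x = m"
        using m(2)[of x] by simp
      then show ?thesis
        using True insert.hyps(2) m by (auto simp: \<rho>'_def)
    next
      case False
      then have "adjacent V x y" "x \<noteq> v"
        using adj insert.hyps(2) by (auto simp: adjacent_def)
      then show ?thesis
        using False \<rho> by (auto simp: \<rho>'_def run_index_def)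
    qed
    ultimately show ?thesis
      unfolding run_index_def by blast
  qed
qed

text \<open>The run of \<open>Min V\<close> heads the list because it is the one to stay uncentred.
  The values of \<open>\<rho>\<close> may have gaps; only their order matters.\<close>

lemma run_index_decomposition:
  assumes "finite V" "V \<noteq> {}" "run_index w V \<rho>"
  shows "\<exists>rs. run_decomposition w (map (\<lambda>r. {x\<in>V. \<rho> x = r}) (\<rho> (Min V) # rs)) \<and>
    set rs = \<rho> ` V - {\<rho> (Min V)}"
proof -
  define rs where "rs = sorted_list_of_set (\<rho> ` V - {\<rho> (Min V)})"
  let ?F = "\<lambda>r. {x\<in>V. \<rho> x = r}"
  have mono: "\<rho> x \<le> \<rho> y" if "x \<in> V" "y \<in> V" "x \<le> y" for x y
    using assms(3) that by (auto simp: run_index_def mono_on_def)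
  have Min: "Min V \<in> V" "\<And>x. x \<in> V \<Longrightarrow> Min V \<le> x"
    using assms by auto
  have set: "set rs = \<rho> ` V - {\<rho> (Min V)}"
    using assms by (simp add: rs_def)
  have sorted: "sorted_wrt (<) (\<rho> (Min V) # rs)"
  proof -
    have "\<rho> (Min V) < r" if "r \<in> \<rho> ` V - {\<rho> (Min V)}" for r
      using that mono Min by (force simp: le_less)
    then show ?thesis
      by (simp add: set) (simp add: rs_def)
  qed
  have increasing: "increasing (map ?F (\<rho> (Min V) # rs))"
    unfolding increasing_def
  proof (intro conjI ballI)
    fix X assume "X \<in> set (map ?F (\<rho> (Min V) # rs))"
    then obtain r where "X = ?F r" "r \<in> \<rho> ` V"
      using set Min by auto
    then show "finite X" "X \<noteq> {}"
      using assms by auto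
  next
    have "x < y" if "x \<in> V" "y \<in> V" "\<rho> x < \<rho> y" for x y
      using mono[of y x] that by (meson leD leI)
    then have "sorted_wrt (\<lambda>r s. \<forall>x\<in>?F r. \<forall>y\<in>?F s. x < y) (\<rho> (Min V) # rs)"
      by (intro sorted_wrt_mono_rel[OF _ sorted]) auto
    then show "sorted_wrt (\<lambda>X Y. \<forall>x\<in>X. \<forall>y\<in>Y. x < y) (map ?F (\<rho> (Min V) # rs))"
      by (simp only: sorted_wrt_map)
  qed
  have alt: "alternating w (?F r)" for r
    unfolding alternating_def
  proof (intro allI impI)
    fix x y assume xy: "adjacent (?F r) x y"
    have "adjacent V x y"
      unfolding adjacent_def
    proof (intro conjI ballI)
      fix z assume z: "z \<in> V"
      show "\<not> (x < z \<and> z < y)"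
      proof
        assume "x < z \<and> z < y"
        moreover from this have "\<rho> z = r"
          using mono[of x z] mono[of z y] z xy by (auto simp: adjacent_def)
        ultimately show False
          using xy z by (auto simp: adjacent_def)
      qed
    qed (use xy in \<open>auto simp: adjacent_def\<close>)
    then have "\<rho> x = \<rho> y \<longleftrightarrow> w x \<noteq> w y"
      using assms(3) unfolding run_index_def by blast
    then show "w x \<noteq> w y"
      using xy by (auto simp: adjacent_def)
  qed
  \<comment> \<open>With no value of \<open>\<rho>\<close> between \<open>r\<close> and
    \<open>s\<close>, the last point of one class and the first of the other are adjacent in
    \<open>V\<close>. Their run indices differ, which means equal letters.\<close>
  have bound: "w (Max (?F r)) = w (Min (?F s))"
    if "r < s" "r \<in> \<rho> ` V" "s \<in> \<rho> ` V" "\<And>t. t \<in> \<rho> ` V \<Longrightarrow> \<not> (r < t \<and> t < s)" for r s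
  proof -
    have fin: "finite (?F r)" "finite (?F s)" "?F r \<noteq> {}" "?F s \<noteq> {}"
      using that assms by auto
    have xy: "Max (?F r) \<in> ?F r" "Min (?F s) \<in> ?F s"
      using Max_in[OF fin(1,3)] Min_in[OF fin(2,4)] by blast+
    have "adjacent V (Max (?F r)) (Min (?F s))"
      unfolding adjacent_def
    proof (intro conjI ballI)
      show "Max (?F r) < Min (?F s)"
      proof (rule ccontr)
        assume "\<not> Max (?F r) < Min (?F s)"
        then have "\<rho> (Min (?F s)) \<le> \<rho> (Max (?F r))"
          using mono[of "Min (?F s)" "Max (?F r)"] xy by simp
        then show False
          using xy that(1) by auto
      qed
      fix z assume z: "z \<in> V"
      show "\<not> (Max (?F r) < z \<and> z < Min (?F s))"
      proof
        assume *: "Max (?F r) < z \<and> z < Min (?F s)"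
        then have "r \<le> \<rho> z" "\<rho> z \<le> s"
          using mono[of "Max (?F r)" z] mono[of z "Min (?F s)"] xy z by auto
        moreover have "\<rho> z \<noteq> r" "\<rho> z \<noteq> s"
          using * z Max_ge[OF fin(1), of z] Min_le[OF fin(2), of z] by auto
        ultimately show False
          using that(4)[of "\<rho> z"] z by auto
      qed
    qed (use xy in auto)
    moreover have "\<rho> (Max (?F r)) \<noteq> \<rho> (Min (?F s))"
      using xy that(1) by auto
    ultimately show ?thesis
      using assms(3) unfolding run_index_def by blast
  qed
  have succ: "successively (\<lambda>X Y. w (Max X) = w (Min Y)) (map ?F (\<rho> (Min V) # rs))"
    unfolding successively_conv_nth
  proof (intro allI impI)
    let ?rs = "\<rho> (Min V) # rs"
    fix i assume "Suc i < length (map ?F ?rs)"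
    then have i: "Suc i < length ?rs"
      by simp
    have set': "set ?rs = \<rho> ` V"
      using set Min by auto
    have "\<not> (?rs ! i < t \<and> t < ?rs ! Suc i)" if "t \<in> \<rho> ` V" for t
    proof -
      from that have "\<exists>k<length ?rs. ?rs ! k = t"
        by (simp only: set'[symmetric] in_set_conv_nth)
      then obtain k where k: "k < length ?rs" "t = ?rs ! k"
        by (elim exE conjE) (rule that[OF _ sym])
      consider "k = i" | "k = Suc i" | "k < i" | "Suc i < k"
        by linarith
      then show ?thesis
        using sorted_wrt_nth_less[OF sorted, of k i] sorted_wrt_nth_less[OF sorted, of "Suc i" k] i k
        by cases (auto dest: less_asym)
    qed
    moreover have "?rs ! i < ?rs ! Suc i"
      using sorted_wrt_nth_less[OF sorted, of i "Suc i"] i by blast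
    moreover have "?rs ! i \<in> \<rho> ` V" "?rs ! Suc i \<in> \<rho> ` V"
      using i nth_mem[of i ?rs] nth_mem[of "Suc i" ?rs] unfolding set' by linarith+
    ultimately have "w (Max (?F (?rs ! i))) = w (Min (?F (?rs ! Suc i)))"
      by (intro bound)
    then show "w (Max (map ?F ?rs ! i)) = w (Min (map ?F ?rs ! Suc i))"
      using i nth_map[of i ?rs ?F] nth_map[of "Suc i" ?rs ?F] by (simp only: Suc_lessD)
  qed
  show ?thesis
    using increasing alt succ set unfolding run_decomposition_def by (intro exI[of _ rs]) auto
qed

text \<open>Remove an interval block \<open>U\<close>. Neighbours in \<open>U\<close> are neighbours
  in \<open>V\<close> and alternate, so \<open>U\<close> lies in one run. If it is a whole run other
  than the first, it is the run sought. If it is the whole first run, the rest is treated on its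
  own. If it is a proper part of a run, its even size makes its end letters differ, so closing the
  gap respects all runs. The same \<open>\<rho>\<close> serves for the rest because its values may
  have gaps.\<close>

lemma run_is_union_of_blocks:
  assumes "finite V" "V \<noteq> {}" "run_index w V \<rho>" "partition_on V \<pi>" "noncrossing \<pi>"
    and "\<forall>U\<in>\<pi>. alternating w U \<and> even (card U)" "\<exists>x\<in>V. \<rho> x \<noteq> \<rho> (Min V)"
  shows "\<exists>r\<in>\<rho> ` V. r \<noteq> \<rho> (Min V) \<and> (\<forall>U\<in>\<pi>. U \<subseteq> {x\<in>V. \<rho> x = r} \<or> U \<inter> {x\<in>V. \<rho> x = r} = {})"
  using assms
proof (induction "card V" arbitrary: V \<pi> rule: less_induct)
  case less
  note fin = less.prems(1) and ne = less.prems(2) and part = less.prems(4)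
  have \<pi>: "\<Union>\<pi> = V"
    using part by (simp add: partition_on_def)
  have mono: "\<rho> x \<le> \<rho> y" if "x \<in> V" "y \<in> V" "x \<le> y" for x y
    using less.prems(3) that by (auto simp: run_index_def mono_on_def)
  have index: "\<rho> x = \<rho> y \<longleftrightarrow> w x \<noteq> w y" if "adjacent V x y" for x y
    using less.prems(3) that by (auto simp: run_index_def)
  have Min: "Min V \<in> V" "\<And>x. x \<in> V \<Longrightarrow> Min V \<le> x"
    using fin ne by auto
  obtain U where U: "interval_block \<pi> U"
    using interval_block_exists[OF part fin ne less.prems(5)] by auto
  have "U \<in> \<pi>"
    using interval_block_mem[OF U] .
  note blocks = partition_on_blocks[OF part fin this]
  have conv: "y \<in> U" if "x \<in> U" "z \<in> U" "x < y" "y < z" "y \<in> V" for x y z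
    using interval_blockD[OF U] that \<pi> by blast
  have altU: "alternating w U" "even (card U)"
    using less.prems(6) \<open>U \<in> \<pi>\<close> by auto
  define u1 u2 where "u1 = Min U" and "u2 = Max U"
  have u: "u1 \<in> U" "u2 \<in> U" "\<And>x. x \<in> U \<Longrightarrow> u1 \<le> x \<and> x \<le> u2"
    using blocks by (auto simp: u1_def u2_def)
  have w_u: "w u1 \<noteq> w u2"
    using Min_Max_alternating[OF blocks(1,2) altU(1)] altU(2) by (simp add: u1_def u2_def)
  define r where "r = \<rho> u1"
  have \<rho>_U: "\<rho> x = r" if "x \<in> U" for x
    using that
  proof (induction x rule: less_induct)
    case (less x)
    show ?case
    proof (cases "x = u1")
      case False
      define p where "p = Max {y\<in>U. y < x}"
      have "finite {y\<in>U. y < x}" "u1 \<in> {y\<in>U. y < x}"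
        using blocks(1) u less.prems False by (auto simp: le_less)
      then have p: "p \<in> U" "p < x" "\<And>y. y \<in> U \<Longrightarrow> y < x \<Longrightarrow> y \<le> p"
        using Max_in[of "{y\<in>U. y < x}"] Max_ge[of "{y\<in>U. y < x}"] unfolding p_def by blast+
      then have adj: "adjacent U p x"
        using less.prems unfolding adjacent_def by (meson leD)
      then have "adjacent V p x"
        using conv[of p x] blocks(3) unfolding adjacent_def by blast
      then have "\<rho> p = \<rho> x"
        using index adj altU(1) unfolding alternating_def by blast
      then show ?thesis
        using less.IH p by simp
    qed (simp add: r_def)
  qed
  let ?V = "V - U" and ?\<pi> = "\<pi> - {U}"
  have disj: "X \<inter> U = {}" if "X \<in> ?\<pi>" for X
    using partition_on_disjointD[OF part] that \<open>U \<in> \<pi>\<close> by blast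
  obtain x1 where x1: "x1 \<in> V" "\<rho> x1 \<noteq> \<rho> (Min V)"
    using less.prems(7) by auto
  \<comment> \<open>A run of the rest that is a union of blocks stays one in \<open>V\<close>:
    putting \<open>U\<close> back enlarges it exactly when \<open>s = r\<close>, and then by a whole
    block.\<close>
  have extend: ?case
    if "s \<in> \<rho> ` ?V" "s \<noteq> \<rho> (Min V)" "s = r \<Longrightarrow> r \<noteq> \<rho> (Min V)"
      "\<forall>X\<in>?\<pi>. X \<subseteq> {x\<in>?V. \<rho> x = s} \<or> X \<inter> {x\<in>?V. \<rho> x = s} = {}" for s
  proof -
    have "X \<subseteq> {x\<in>V. \<rho> x = s} \<or> X \<inter> {x\<in>V. \<rho> x = s} = {}" if X: "X \<in> \<pi>" for X
    proof (cases "X = U")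
      case True
      then show ?thesis
        using \<rho>_U blocks(3) by blast
    next
      case False
      then show ?thesis
        using that(1) \<open>\<forall>X\<in>?\<pi>. _ X\<close> X disj[of X] by blast
    qed
    then show ?thesis
      using that by blast
  qed
  show ?case
  proof (cases "U = {x\<in>V. \<rho> x = r}")
    case True
    show ?thesis
    proof (cases "r = \<rho> (Min V)")
      case False
      then show ?thesis
        using True disj blocks(3) u(1) r_def by (intro bexI[of _ r]) blast+
    next
      case r: True
      have "x1 \<in> ?V"
        using x1 \<rho>_U r by auto
      then have ne': "?V \<noteq> {}"
        by auto
      have r': "\<rho> x \<noteq> r" if "x \<in> ?V" for x
        using that True by auto
      have part': "partition_on ?V ?\<pi>"
        using partition_on_remove[OF part \<open>U \<in> \<pi>\<close>] .
      have Min': "Min ?V \<in> ?V"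
        using fin ne' by (intro Min_in) auto
      \<comment> \<open>Every run of the rest differs from the first run of \<open>V\<close>. If the
        rest is one run, it contains all remaining blocks; otherwise the induction hypothesis
        supplies a run.\<close>
      show ?thesis
      proof (cases "\<exists>x\<in>?V. \<rho> x \<noteq> \<rho> (Min ?V)")
        case False
        show ?thesis
        proof (rule extend[of "\<rho> (Min ?V)"])
          show "\<forall>X\<in>?\<pi>. X \<subseteq> {x\<in>?V. \<rho> x = \<rho> (Min ?V)} \<or> X \<inter> {x\<in>?V. \<rho> x = \<rho> (Min ?V)} = {}"
            using False part' by (auto simp: partition_on_def)
        qed (use Min' r' r in auto)
      next
        case True': True
        have "run_index w ?V \<rho>"
          unfolding run_index_def
        proof (intro conjI allI impI)
          show "mono_on ?V \<rho>"
            using mono by (auto simp: mono_on_def)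
          fix x y assume xy: "adjacent ?V x y"
          have "z \<notin> U" if "x < z" for z
          proof
            assume "z \<in> U"
            then have "\<rho> x \<le> r"
              using mono[of x z] \<rho>_U[of z] blocks(3) xy that by (auto simp: adjacent_def)
            moreover have "r \<le> \<rho> x"
              using mono[of "Min V" x] Min xy by (auto simp: r adjacent_def)
            ultimately show False
              using r'[of x] xy by (auto simp: adjacent_def)
          qed
          then have "adjacent V x y"
            using xy unfolding adjacent_def by blast
          then show "\<rho> x = \<rho> y \<longleftrightarrow> w x \<noteq> w y"
            by (rule index)
        qed
        moreover have "card ?V < card V"
          using fin blocks by (intro psubset_card_mono) auto
        moreover have "noncrossing ?\<pi>"
          by (rule noncrossing_subset[OF less.prems(5)]) blast
        ultimately have "\<exists>s\<in>\<rho> ` ?V. s \<noteq> \<rho> (Min ?V) \<and>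
            (\<forall>X\<in>?\<pi>. X \<subseteq> {x\<in>?V. \<rho> x = s} \<or> X \<inter> {x\<in>?V. \<rho> x = s} = {})"
          using fin ne' part' less.prems(6) True' by (intro less.hyps) auto
        then obtain s where s: "s \<in> \<rho> ` ?V"
            "\<forall>X\<in>?\<pi>. X \<subseteq> {x\<in>?V. \<rho> x = s} \<or> X \<inter> {x\<in>?V. \<rho> x = s} = {}"
          by blast
        show ?thesis
        proof (rule extend[OF s(1) _ _ s(2)])
          from s(1) obtain x where "x \<in> ?V" "s = \<rho> x"
            by blast
          with r'[of x] r show "s \<noteq> \<rho> (Min V)" "s = r \<Longrightarrow> r \<noteq> \<rho> (Min V)"
            by simp_all
        qed
      qed
    qed
  next
    case False
    then obtain x0 where x0: "x0 \<in> ?V" "\<rho> x0 = r"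
      using \<rho>_U blocks(3) by blast
    have part': "partition_on ?V ?\<pi>"
      using partition_on_remove[OF part \<open>U \<in> \<pi>\<close>] .
    have Min': "Min ?V \<in> ?V" "\<And>x. x \<in> ?V \<Longrightarrow> Min ?V \<le> x"
      using x0 fin Min_in[of ?V] by auto
    \<comment> \<open>A point \<open>x0\<close> of the run of \<open>U\<close> survives, so the
      first run remains the first even if \<open>U\<close> contains \<open>Min V\<close>.\<close>
    have \<rho>_Min: "\<rho> (Min ?V) = \<rho> (Min V)"
    proof (cases "Min V \<in> U")
      case True
      then have "r = \<rho> (Min V)"
        using \<rho>_U by simp
      moreover have "\<rho> (Min ?V) \<le> r" "\<rho> (Min V) \<le> \<rho> (Min ?V)"
        using mono[of "Min ?V" x0] mono[of "Min V" "Min ?V"] Min Min' x0 by auto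
      ultimately show ?thesis by simp
    next
      case False
      then have "Min ?V = Min V"
        using Min Min' by (intro antisym) auto
      then show ?thesis by simp
    qed
    have "run_index w ?V \<rho>"
      unfolding run_index_def
    proof (intro conjI allI impI)
      show "mono_on ?V \<rho>"
        using mono by (auto simp: mono_on_def)
      fix x y assume xy: "adjacent ?V x y"
      then have xyV: "x \<in> V" "x \<notin> U" "y \<in> V" "y \<notin> U" "x < y" and gap: "\<And>z. z \<in> V \<Longrightarrow> x < z \<Longrightarrow> z < y \<Longrightarrow> z \<in> U"
        by (auto simp: adjacent_def)
      show "\<rho> x = \<rho> y \<longleftrightarrow> w x \<noteq> w y"
      proof (cases "\<exists>z\<in>U. x < z \<and> z < y")
        case False
        then have "adjacent V x y"
          using xy unfolding adjacent_def by blast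
        then show ?thesis
          by (rule index)
      next
        case True
        then obtain z where z: "z \<in> U" "x < z" "z < y"
          by auto
        have u1: "x < u1"
          using conv[OF u(1) z(1), of x] z u(3)[OF z(1)] xyV u(1) by (metis linorder_neqE_nat)
        have u2: "u2 < y"
          using conv[OF z(1) u(2), of y] z u(3)[OF z(1)] xyV u(2) by (metis linorder_neqE_nat)
        have "u1 \<le> u2"
          using u by auto
        have "adjacent V x u1"
          unfolding adjacent_def
        proof (intro conjI ballI notI)
          fix v assume v: "v \<in> V" "x < v \<and> v < u1"
          then have "v \<in> U"
            using gap[of v] u2 \<open>u1 \<le> u2\<close> by auto
          then show False
            using u(3)[of v] v by auto
        qed (use xyV u u1 blocks(3) in auto)
        then have eq1: "\<rho> x = r \<longleftrightarrow> w x \<noteq> w u1"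
          using index by (simp add: r_def)
        have "adjacent V u2 y"
          unfolding adjacent_def
        proof (intro conjI ballI notI)
          fix v assume v: "v \<in> V" "u2 < v \<and> v < y"
          then have "v \<in> U"
            using gap[of v] u1 \<open>u1 \<le> u2\<close> by auto
          then show False
            using u(3)[of v] v by auto
        qed (use xyV u u2 blocks(3) in auto)
        then have eq2: "r = \<rho> y \<longleftrightarrow> w u2 \<noteq> w y"
          using index[of u2 y] \<rho>_U[OF u(2)] by simp
        have "\<rho> x \<le> r" "r \<le> \<rho> y"
          using mono[of x u1] mono[of u2 y] \<rho>_U u u1 u2 xyV blocks(3) by auto
        \<comment> \<open>The surviving point \<open>x0\<close> puts \<open>x\<close> or
          \<open>y\<close> into the run of \<open>U\<close>. If it is \<open>x\<close>, then its
          letter differs from that at \<open>u1\<close> and so equals that at \<open>u2\<close>;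
          comparing \<open>y\<close> with \<open>u2\<close> is then comparing it with
          \<open>x\<close>. The case of \<open>y\<close> is symmetric.\<close>
        moreover have "x0 \<le> x \<or> y \<le> x0"
          using gap[of x0] x0 by fastforce
        ultimately have "\<rho> x = r \<or> \<rho> y = r"
          using mono[of x0 x] mono[of y x0] x0 xyV by auto
        then show ?thesis
          using eq1 eq2 w_u by auto
      qed
    qed
    moreover have "card ?V < card V"
      using fin blocks by (intro psubset_card_mono) auto
    moreover have "noncrossing ?\<pi>"
      by (rule noncrossing_subset[OF less.prems(5)]) blast
    moreover have "\<exists>x\<in>?V. \<rho> x \<noteq> \<rho> (Min ?V)"
      using x1 x0 \<rho>_U unfolding \<rho>_Min by (metis DiffI)
    ultimately have "\<exists>s\<in>\<rho> ` ?V. s \<noteq> \<rho> (Min ?V) \<and>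
        (\<forall>X\<in>?\<pi>. X \<subseteq> {x\<in>?V. \<rho> x = s} \<or> X \<inter> {x\<in>?V. \<rho> x = s} = {})"
      using fin x0 part' less.prems(6) by (intro less.hyps) auto
    then obtain s where s: "s \<in> \<rho> ` ?V" "s \<noteq> \<rho> (Min V)"
        "\<forall>X\<in>?\<pi>. X \<subseteq> {x\<in>?V. \<rho> x = s} \<or> X \<inter> {x\<in>?V. \<rho> x = s} = {}"
      unfolding \<rho>_Min by blast
    show ?thesis
      by (rule extend[OF s(1,2) _ s(3)]) (use s(2) in auto)
  qed
qed

section \<open>Partitioned cumulants\<close>


lemma NC_moebius_sum:
  assumes "\<tau> \<in> NC n" "\<sigma> \<in> NC n" "refines {1..n} \<tau> \<sigma>"
  shows "(\<Sum>\<pi> | \<pi> \<in> NC n \<and> refines {1..n} \<pi> \<sigma> \<and> refines {1..n} \<tau> \<pi>. NC_moebius n \<tau> \<pi>) = (if \<tau> = \<sigma> then 1 else 0)"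
proof (cases "\<tau> = \<sigma>")
  case True
  then have "{\<pi>. \<pi> \<in> NC n \<and> refines {1..n} \<pi> \<sigma> \<and> refines {1..n} \<tau> \<pi>} = {\<sigma>}"
    using assms refines_asym by blast
  then show ?thesis
    using True assms by (simp add: NC_moebius.simps[of n \<sigma> \<sigma>])
next
  case False
  let ?A = "{\<pi> \<in> NC n. refines {1..n} \<tau> \<pi> \<and> refines {1..n} \<pi> \<sigma> \<and> \<pi> \<noteq> \<sigma>}"
  have "refines {1..n} \<sigma> \<sigma>"
    using assms(2) by (auto simp: NC_def intro: refines_refl)
  then have "{\<pi>. \<pi> \<in> NC n \<and> refines {1..n} \<pi> \<sigma> \<and> refines {1..n} \<tau> \<pi>} = insert \<sigma> ?A"
    using assms by blast
  moreover have "finite ?A"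
    using finite_NC by simp
  ultimately show ?thesis
    using False assms by (simp add: NC_moebius.simps[of n \<tau> \<sigma>])
qed

text \<open>If \<open>\<pi>\<close> is a partition, then \<open>I\<close> is a union of blocks of \<open>\<pi>\<close>.\<close>

definition saturated :: "nat set set \<Rightarrow> nat set \<Rightarrow> bool" where
  "saturated \<pi> I \<longleftrightarrow> (\<forall>U\<in>\<pi>. U \<subseteq> I \<or> U \<inter> I = {})"

lemma refines_split_block:
  assumes "partition_on S \<sigma>" "V \<in> \<sigma>" "I \<subseteq> V" "I \<noteq> {}" "V - I \<noteq> {}"
  shows "refines S \<pi> (split_block V I \<sigma>) \<longleftrightarrow> refines S \<pi> \<sigma> \<and> saturated \<pi> I"
proof -
  have disj: "Y \<inter> I = {}" if "Y \<in> \<sigma> - {V}" for Y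
    using partition_on_disjointD[OF assms(1), of Y V] that assms(2,3) by blast
  have "(\<forall>X\<in>\<pi>. \<exists>Y\<in>split_block V I \<sigma>. X \<subseteq> Y) \<longleftrightarrow> (\<forall>X\<in>\<pi>. \<exists>Y\<in>\<sigma>. X \<subseteq> Y) \<and> saturated \<pi> I" (is "?L \<longleftrightarrow> ?R")
  proof
    assume L: ?L
    have "(\<exists>Y\<in>\<sigma>. X \<subseteq> Y) \<and> (X \<subseteq> I \<or> X \<inter> I = {})" if X: "X \<in> \<pi>" for X
    proof -
      obtain Y where "Y = I \<or> Y = V - I \<or> Y \<in> \<sigma> - {V}" "X \<subseteq> Y"
        using L X unfolding split_block_def by blast
      then show ?thesis
        using disj assms(2,3) by blast
    qed
    then show ?R
      unfolding saturated_def by blast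
  next
    assume R: ?R
    have "\<exists>Y\<in>split_block V I \<sigma>. X \<subseteq> Y" if X: "X \<in> \<pi>" for X
    proof -
      have "\<exists>Y\<in>\<sigma>. X \<subseteq> Y" "X \<subseteq> I \<or> X \<inter> I = {}"
        using R X by (simp_all add: saturated_def)
      then obtain Y where Y: "Y \<in> \<sigma>" "X \<subseteq> Y" "X \<subseteq> I \<or> X \<inter> I = {}"
        by blast
      then have "X \<subseteq> I \<or> X \<subseteq> V - I \<or> Y \<in> \<sigma> - {V}"
        by blast
      then show ?thesis
        using Y(2) by (simp only: split_block_def bex_simps) blast
    qed
    then show ?L ..
  qed
  then show ?thesis
    using partition_on_split_block[OF assms] assms(1) by (simp add: refines_def)
qed

text \<open>A crossing of \<open>I\<close> or \<open>V - I\<close> with another block would be one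
  of \<open>V\<close>, and the two parts do not cross each other because \<open>I\<close> is an
  interval within \<open>V\<close>.\<close>

lemma noncrossing_split_block:
  assumes "noncrossing \<sigma>" "V \<in> \<sigma>" "I \<subseteq> V"
    and conv: "\<And>x y z. x \<in> I \<Longrightarrow> z \<in> I \<Longrightarrow> y \<in> V \<Longrightarrow> x < y \<Longrightarrow> y < z \<Longrightarrow> y \<in> I"
  shows "noncrossing (split_block V I \<sigma>)"
  unfolding noncrossing_def
proof (intro ballI impI)
  fix X Y i j k l
  assume XY: "X \<in> split_block V I \<sigma>" "Y \<in> split_block V I \<sigma>"
    and ijkl: "i \<in> X" "j \<in> Y" "k \<in> X" "l \<in> Y" and less: "i < j \<and> j < k \<and> k < l"
  have nc: "X' = Y'" if "X' \<in> \<sigma>" "Y' \<in> \<sigma>" "X \<subseteq> X'" "Y \<subseteq> Y'" for X' Y'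
    using assms(1)[unfolded noncrossing_def, rule_format, of X' Y' i j k l] that ijkl less by blast
  have mem: "(X = I \<or> X = V - I) \<or> X \<in> \<sigma> - {V}" "(Y = I \<or> Y = V - I) \<or> Y \<in> \<sigma> - {V}"
    using XY unfolding split_block_def by blast+
  then consider "X \<in> \<sigma> - {V}" "Y \<in> \<sigma> - {V}" | "X \<subseteq> V" "Y \<in> \<sigma> - {V}" | "X \<in> \<sigma> - {V}" "Y \<subseteq> V"
    | "X = Y" | "X = I" "Y = V - I" | "X = V - I" "Y = I"
    using assms(3) by blast
  then show "X = Y"
  proof cases
    case 1
    then show ?thesis using nc by blast
  next
    case 2
    then show ?thesis using nc[of V Y] assms(2) by blast
  next
    case 3
    then show ?thesis using nc[of X V] assms(2) by blast
  next
    case 5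
    then show ?thesis using conv[of i k j] ijkl less by blast
  next
    case 6
    then show ?thesis using conv[of j l k] ijkl less by blast
  qed
qed

section \<open>Moebius inversion of partitioned moments\<close>

context nc_prob_space
begin

definition partitioned_cumulant :: "nat \<Rightarrow> (nat \<Rightarrow> 'a) \<Rightarrow> nat set set \<Rightarrow> 'a" where
  "partitioned_cumulant n a \<pi> =
     (\<Sum>\<tau> | \<tau> \<in> NC n \<and> refines {1..n} \<tau> \<pi>. scale (of_int (NC_moebius n \<tau> \<pi>)) (phi_hat \<phi> \<tau> a))"

lemma phi_hat_eq_sum_partitioned_cumulant:
  assumes "\<sigma> \<in> NC n"
  shows "phi_hat \<phi> \<sigma> a = (\<Sum>\<pi> | \<pi> \<in> NC n \<and> refines {1..n} \<pi> \<sigma>. partitioned_cumulant n a \<pi>)"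
proof -
  let ?A = "{\<pi>. \<pi> \<in> NC n \<and> refines {1..n} \<pi> \<sigma>}"
  have "(\<Sum>\<pi>\<in>?A. partitioned_cumulant n a \<pi>) =
      (\<Sum>\<tau>\<in>NC n. \<Sum>\<pi> | \<pi> \<in> ?A \<and> refines {1..n} \<tau> \<pi>. scale (of_int (NC_moebius n \<tau> \<pi>)) (phi_hat \<phi> \<tau> a))"
    unfolding partitioned_cumulant_def using finite_NC[of n] by (intro sum.swap_restrict) auto
  also have "\<dots> = (\<Sum>\<tau>\<in>NC n. if \<tau> = \<sigma> then phi_hat \<phi> \<sigma> a else 0)"
  proof (rule sum.cong)
    fix \<tau> assume \<tau>: "\<tau> \<in> NC n"
    have *: "(\<Sum>\<pi> | \<pi> \<in> ?A \<and> refines {1..n} \<tau> \<pi>. scale (of_int (NC_moebius n \<tau> \<pi>)) (phi_hat \<phi> \<tau> a)) =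
        scale (of_int (\<Sum>\<pi> | \<pi> \<in> NC n \<and> refines {1..n} \<pi> \<sigma> \<and> refines {1..n} \<tau> \<pi>. NC_moebius n \<tau> \<pi>)) (phi_hat \<phi> \<tau> a)"
      by (simp add: scale_sum_left conj_assoc)
    show "(\<Sum>\<pi> | \<pi> \<in> ?A \<and> refines {1..n} \<tau> \<pi>. scale (of_int (NC_moebius n \<tau> \<pi>)) (phi_hat \<phi> \<tau> a)) =
        (if \<tau> = \<sigma> then phi_hat \<phi> \<sigma> a else 0)"
    proof (cases "refines {1..n} \<tau> \<sigma>")
      case True
      then show ?thesis
        unfolding * NC_moebius_sum[OF \<tau> assms True] by simp
    next
      case False
      then have "{\<pi>. \<pi> \<in> ?A \<and> refines {1..n} \<tau> \<pi>} = {}" "\<tau> \<noteq> \<sigma>"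
        using refines_trans[of "{1..n}" \<tau> _ \<sigma>] assms refines_refl[of "{1..n}" \<sigma>] by (auto simp: NC_def)
      then show ?thesis
        by (simp only: sum.empty if_False)
    qed
  qed simp
  also have "\<dots> = phi_hat \<phi> \<sigma> a"
    using assms finite_NC by simp
  finally show ?thesis ..
qed

text \<open>Splitting off \<open>I\<close> restricts the sum over partitions below
  \<open>\<sigma>\<close> to those for which \<open>I\<close> is a union of blocks. Each difference
  in the recursion therefore discards exactly these.\<close>

lemma centered_eq_sum_partitioned_cumulant:
  assumes "increasing (V1 # Is)" "V = V1 \<union> \<Union>(set Is)" "\<sigma> \<in> NC n" "V \<in> \<sigma>"
  shows "centered Is \<sigma> V a = (\<Sum>\<pi> | \<pi> \<in> NC n \<and> refines {1..n} \<pi> \<sigma> \<and> (\<forall>I\<in>set Is. \<not> saturated \<pi> I).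
    partitioned_cumulant n a \<pi>)"
  using assms
proof (induction Is arbitrary: V1 V \<sigma>)
  case Nil
  then show ?case
    by (simp add: phi_hat_eq_sum_partitioned_cumulant)
next
  case (Cons I Is)
  have I: "I \<subseteq> V" "I \<noteq> {}" "V - I = V1 \<union> \<Union>(set Is)" "V - I \<noteq> {}"
    using Cons.prems(1) increasing_diff[OF Cons.prems(1)] Cons.prems(2) by (auto simp: increasing_def)
  have \<sigma>: "partition_on {1..n} \<sigma>" "noncrossing \<sigma>"
    using Cons.prems(3) by (auto simp: NC_def)
  have "noncrossing (split_block V I \<sigma>)"
    using increasing_convex[OF Cons.prems(1)] Cons.prems(2)
    by (intro noncrossing_split_block[OF \<sigma>(2) Cons.prems(4) I(1)]) blast
  then have split: "split_block V I \<sigma> \<in> NC n"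
    using partition_on_split_block[OF \<sigma>(1) Cons.prems(4) I(1,2,4)] by (simp add: NC_def)
  define A where "A = {\<pi>. \<pi> \<in> NC n \<and> refines {1..n} \<pi> \<sigma> \<and> (\<forall>I\<in>set Is. \<not> saturated \<pi> I)}"
  have A: "finite A" "{\<pi>. \<pi> \<in> NC n \<and> refines {1..n} \<pi> (split_block V I \<sigma>) \<and> (\<forall>I\<in>set Is. \<not> saturated \<pi> I)} =
      {\<pi>\<in>A. saturated \<pi> I}"
    "{\<pi>. \<pi> \<in> NC n \<and> refines {1..n} \<pi> \<sigma> \<and> (\<forall>J\<in>set (I # Is). \<not> saturated \<pi> J)} = A - {\<pi>\<in>A. saturated \<pi> I}"
    unfolding A_def refines_split_block[OF \<sigma>(1) Cons.prems(4) I(1,2,4)] using finite_NC[of n] by auto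
  have "centered Is \<sigma> V a = (\<Sum>\<pi>\<in>A. partitioned_cumulant n a \<pi>)"
    unfolding A_def using Cons.prems
    by (intro Cons.IH[OF increasing_merge[OF Cons.prems(1)]]) auto
  moreover have "centered Is (split_block V I \<sigma>) (V - I) a = (\<Sum>\<pi>\<in>{\<pi>\<in>A. saturated \<pi> I}. partitioned_cumulant n a \<pi>)"
    unfolding A(2)[symmetric] using split I(3)
    by (intro Cons.IH[OF increasing_drop[OF Cons.prems(1)]]) (auto simp: split_block_def)
  moreover have "(\<Sum>\<pi>\<in>A - {\<pi>\<in>A. saturated \<pi> I}. partitioned_cumulant n a \<pi>) =
      (\<Sum>\<pi>\<in>A. partitioned_cumulant n a \<pi>) - (\<Sum>\<pi>\<in>{\<pi>\<in>A. saturated \<pi> I}. partitioned_cumulant n a \<pi>)"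
    using A(1) by (intro sum_diff) auto
  ultimately show ?case
    unfolding A(3) by simp
qed

lemma phi_hat_in_B: "phi_hat \<phi> \<pi> a \<in> B"
proof (induction "card \<pi>" arbitrary: \<pi> a rule: less_induct)
  case less
  show ?case
  proof (cases "card \<pi> > 1 \<and> (\<exists>V. interval_block \<pi> V)")
    case True
    define V where "V = (SOME V. interval_block \<pi> V)"
    have "interval_block \<pi> V"
      unfolding V_def using True by (auto intro: someI_ex)
    then have "V \<in> \<pi>"
      by (rule interval_block_mem)
    then have "card (\<pi> - {V}) < card \<pi>"
      using True card_ge_0_finite[of \<pi>] by (intro card_Diff1_less) auto
    then show ?thesis
      using True less.hyps by (simp add: phi_hat.simps[of _ \<pi>] Let_def V_def)
  next
    case False
    show ?thesis
      unfolding phi_hat.simps[of _ \<pi>] if_not_P[OF False] by simp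
  qed
qed

lemma B_sum: "(\<And>i. i \<in> I \<Longrightarrow> f i \<in> B) \<Longrightarrow> sum f I \<in> B"
  by (induction I rule: infinite_finite_induct) auto

lemma cumulant_in_B: "cumulant scale \<phi> n a \<in> B"
  unfolding cumulant_def by (intro B_sum B_scale phi_hat_in_B)

lemma cumulant_eq_partitioned_cumulant:
  assumes "n \<ge> 1"
  shows "cumulant scale \<phi> n a = partitioned_cumulant n a {{1..n}}"
proof -
  have "partition_on {1..n} {{1..n}}"
    using assms by (intro partition_on_space) auto
  then have "refines {1..n} \<pi> {{1..n}}" if "\<pi> \<in> NC n" for \<pi>
    using that by (auto simp: NC_def refines_def partition_on_def)
  then have "{\<pi>. \<pi> \<in> NC n \<and> refines {1..n} \<pi> {{1..n}}} = NC n"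
    by auto
  then show ?thesis
    by (simp add: cumulant_def partitioned_cumulant_def)
qed

end

section \<open>Vanishing of cumulants with a bad block\<close>

context free_even_pair
begin

text \<open>Induction on the number of noncrossing partitions below \<open>\<sigma>\<close>. In the
  relation for \<open>V\<close>, a strictly finer \<open>\<pi>\<close> with a bad block drops out by
  induction, and one without is excluded by its restriction to \<open>V\<close>. Only the term of
  \<open>\<sigma>\<close> is left.\<close>

lemma partitioned_cumulant_eq_0:
  assumes "\<sigma> \<in> NC n" "V \<in> \<sigma>" "\<not> (alternating w V \<and> even (card V))" "\<forall>x\<in>{1..n}. a x \<in> letter (w x)"
  shows "partitioned_cumulant n a \<sigma> = 0"
  using assms(1-3)
proof (induction "card {\<rho> \<in> NC n. refines {1..n} \<rho> \<sigma>}" arbitrary: \<sigma> V rule: less_induct)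
  case less
  have \<sigma>: "partition_on {1..n} \<sigma>" "noncrossing \<sigma>"
    using less.prems(1) by (auto simp: NC_def)
  have V: "finite V" "V \<noteq> {}" "V \<subseteq> {1..n}"
    using partition_on_blocks[OF \<sigma>(1) _ less.prems(2)] by auto
  have Min: "Min V \<in> V"
    using V by simp
  obtain \<rho> where \<rho>: "run_index w V \<rho>"
    using run_index_exists[OF V(1)] by blast
  define F where "F = (\<lambda>r. {x\<in>V. \<rho> x = r})"
  obtain rs where rs: "run_decomposition w (map F (\<rho> (Min V) # rs))" "set rs = \<rho> ` V - {\<rho> (Min V)}"
    using run_index_decomposition[OF V(1,2) \<rho>] unfolding F_def by blast
  define V1 Is where "V1 = F (\<rho> (Min V))" and "Is = map F rs"
  have decomp: "run_decomposition w (V1 # Is)"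
    using rs(1) by (simp add: V1_def Is_def)
  have inc: "increasing (V1 # Is)"
    using decomp by (simp add: run_decomposition_def)
  have set_Is: "set Is = F ` (\<rho> ` V - {\<rho> (Min V)})"
    using rs(2) by (simp add: Is_def)
  have V_eq: "V = V1 \<union> \<Union>(set Is)"
    unfolding set_Is V1_def F_def by auto
  have rs_Nil: "alternating w V" if "rs = []"
  proof -
    have "V = V1"
      using that V_eq by (simp add: Is_def)
    then show ?thesis
      using decomp by (simp add: run_decomposition_def)
  qed
  \<comment> \<open>If there is one run, then \<open>V\<close> is alternating and can be bad only
    through odd size; its end letters then agree.\<close>
  have "Is \<noteq> [] \<or> w (Min V1) = w (Max V1)"
  proof (cases "rs = []")
    case True
    then have "V = V1"
      using V_eq by (simp add: Is_def)
    then show ?thesis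
      using Min_Max_alternating[OF V(1,2) rs_Nil[OF True]] less.prems(3) rs_Nil[OF True] by simp
  qed (simp add: Is_def)
  then have "centered Is \<sigma> V a = 0"
    using \<sigma> less.prems(2) V_eq decomp V(3) assms(4) by (intro centered_eq_0) auto
  define A where "A = {\<pi>. \<pi> \<in> NC n \<and> refines {1..n} \<pi> \<sigma> \<and> (\<forall>I\<in>set Is. \<not> saturated \<pi> I)}"
  have sum: "(\<Sum>\<pi>\<in>A. partitioned_cumulant n a \<pi>) = 0"
    using centered_eq_sum_partitioned_cumulant[OF inc V_eq less.prems(1,2), of a] \<open>centered Is \<sigma> V a = 0\<close>
    by (simp add: A_def)
  \<comment> \<open>\<open>V\<close> is a block of \<open>\<sigma>\<close> that meets
    \<open>I\<close> and contains \<open>Min V\<close> outside \<open>I\<close>, so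
    \<open>\<sigma>\<close> itself takes part in the sum.\<close>
  have "\<not> saturated \<sigma> I" if "I \<in> set Is" for I
  proof -
    obtain r where r: "r \<in> \<rho> ` V" "r \<noteq> \<rho> (Min V)" "I = F r"
      using \<open>I \<in> set Is\<close> unfolding set_Is by auto
    then have "Min V \<notin> I" "V \<inter> I \<noteq> {}"
      by (auto simp: F_def)
    then show ?thesis
      using less.prems(2) Min unfolding saturated_def by blast
  qed
  then have "\<sigma> \<in> A"
    using less.prems(1) refines_refl[OF \<sigma>(1)] by (simp add: A_def)
  moreover have "partitioned_cumulant n a \<pi> = 0" if "\<pi> \<in> A - {\<sigma>}" for \<pi>
  proof (cases "\<exists>U\<in>\<pi>. \<not> (alternating w U \<and> even (card U))")
    case True
    then obtain U where U: "U \<in> \<pi>" "\<not> (alternating w U \<and> even (card U))"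
      by blast
    have \<pi>: "\<pi> \<in> NC n" "refines {1..n} \<pi> \<sigma>" "\<pi> \<noteq> \<sigma>"
      using that by (auto simp: A_def)
    have "{\<rho> \<in> NC n. refines {1..n} \<rho> \<pi>} \<subseteq> {\<rho> \<in> NC n. refines {1..n} \<rho> \<sigma>}"
      using refines_trans[OF _ \<pi>(2)] by blast
    moreover have "\<sigma> \<in> {\<rho> \<in> NC n. refines {1..n} \<rho> \<sigma>} - {\<rho> \<in> NC n. refines {1..n} \<rho> \<pi>}"
      using less.prems(1) refines_refl[OF \<sigma>(1)] refines_asym[OF \<pi>(2)] \<pi>(3) by blast
    ultimately have "{\<rho> \<in> NC n. refines {1..n} \<rho> \<pi>} \<subset> {\<rho> \<in> NC n. refines {1..n} \<rho> \<sigma>}"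
      by blast
    then have "card {\<rho> \<in> NC n. refines {1..n} \<rho> \<pi>} < card {\<rho> \<in> NC n. refines {1..n} \<rho> \<sigma>}"
      using finite_NC[of n] by (intro psubset_card_mono) simp
    then show ?thesis
      using U \<pi>(1) by (intro less.hyps)
  next
    case False
    define \<pi>V where "\<pi>V = {U\<in>\<pi>. U \<subseteq> V}"
    have \<pi>: "\<pi> \<in> NC n" "refines {1..n} \<pi> \<sigma>" "\<And>I. I \<in> set Is \<Longrightarrow> \<not> saturated \<pi> I"
      using that by (auto simp: A_def)
    have part: "partition_on V \<pi>V"
      unfolding \<pi>V_def by (rule refines_obtains_subset[OF \<pi>(2) less.prems(2)])
    have balanced: "\<forall>U\<in>\<pi>V. alternating w U \<and> even (card U)"
      using False by (auto simp: \<pi>V_def)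
    show ?thesis
    proof (cases "rs = []")
      case True
      \<comment> \<open>A single run has odd size here, which disjoint blocks of even size cannot
        fill.\<close>
      have "card (\<Union>\<pi>V) = sum card \<pi>V"
        using part partition_on_blocks[OF part V(1)] by (intro card_Union_disjoint) (auto simp: partition_on_def)
      also have "even (sum card \<pi>V)"
        using balanced by (intro dvd_sum) auto
      finally have "even (card V)"
        using part by (simp add: partition_on_def)
      then show ?thesis
        using rs_Nil[OF True] less.prems(3) by blast
    next
      case ne: False
      then obtain r where "r \<in> set rs"
        by (cases rs) auto
      then have "r \<in> \<rho> ` V - {\<rho> (Min V)}"
        unfolding rs(2) .
      then have "\<exists>x\<in>V. \<rho> x \<noteq> \<rho> (Min V)"
        by blast
      moreover have "noncrossing \<pi>V"
      proof (rule noncrossing_subset)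
        show "noncrossing \<pi>"
          using \<pi>(1) by (simp add: NC_def)
      qed (auto simp: \<pi>V_def)
      ultimately obtain r where r: "r \<in> \<rho> ` V" "r \<noteq> \<rho> (Min V)"
          "\<forall>U\<in>\<pi>V. U \<subseteq> F r \<or> U \<inter> F r = {}"
        using run_is_union_of_blocks[OF V(1,2) \<rho> part _ balanced] unfolding F_def by blast
      have "U \<subseteq> F r \<or> U \<inter> F r = {}" if "U \<in> \<pi>" for U
      proof (cases "U \<subseteq> V")
        case True
        then show ?thesis
          using r(3) \<open>U \<in> \<pi>\<close> by (auto simp: \<pi>V_def)
      next
        case False
        obtain Y where "Y \<in> \<sigma>" "U \<subseteq> Y"
          using \<pi>(2) \<open>U \<in> \<pi>\<close> unfolding refines_def by blast
        then have "U \<inter> V = {}"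
          using partition_on_disjointD[OF \<sigma>(1), of Y V] less.prems(2) False by blast
        then show ?thesis
          by (auto simp: F_def)
      qed
      then have "saturated \<pi> (F r)"
        by (simp add: saturated_def)
      then show ?thesis
        using \<pi>(3)[of "F r"] r set_Is by blast
    qed
  qed
  moreover have "finite A"
    using finite_NC[of n] by (simp add: A_def)
  ultimately show ?case
    using sum by (simp add: sum.remove)
qed

lemma cumulant_eq_0:
  assumes "n \<ge> 1" "\<not> (alternating w {1..n} \<and> even n)" "\<forall>x\<in>{1..n}. a x \<in> letter (w x)"
  shows "cumulant scale \<phi> n a = 0"
proof -
  have "{{1..n}} \<in> NC n"
    using assms(1) partition_on_space[of "{1..n}"] by (auto simp: NC_def noncrossing_def)
  then show ?thesis
    using assms partitioned_cumulant_eq_0[of "{{1..n}}" n "{1..n}" w a]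
    by (simp add: cumulant_eq_partitioned_cumulant)
qed

end

section \<open>Reading off the two series\<close>

lemma concat_replicate_eq_iff:
  assumes "u \<noteq> []"
  shows "concat (replicate m u) = concat (replicate k u) \<longleftrightarrow> m = k"
proof
  assume "concat (replicate m u) = concat (replicate k u)"
  then have "length (concat (replicate m u)) = length (concat (replicate k u))"
    by simp
  then show "m = k"
    using assms by (simp add: length_concat sum_list_replicate)
qed simp

text \<open>The one-variable series takes its \<open>m\<close>-th coefficient from \<open>F\<close>
  at the \<open>m\<close>-th power of \<open>u\<close>; substituting \<open>u\<close> back recovers
  \<open>F\<close> on these powers because the exponent is unique.\<close>

lemma subst_monomial_extract:
  assumes "u \<noteq> []"
  shows "subst_monomial (\<lambda>v. if v \<in> words 1 then F (concat (replicate (length v) u)) else 0) u w =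
    (if \<exists>m\<ge>1. w = concat (replicate m u) then F w else 0)"
proof (cases "\<exists>m\<ge>1. w = concat (replicate m u)")
  case True
  then obtain m where m: "m \<ge> 1" "w = concat (replicate m u)"
    by blast
  then have "{k. k \<ge> 1 \<and> concat (replicate k u) = w} = {m}"
    using concat_replicate_eq_iff[OF assms] by auto
  moreover have "replicate m 1 \<in> words 1"
    using m(1) by (auto simp: words_def)
  ultimately show ?thesis
    using True m by (simp add: subst_monomial_def)
next
  case False
  then have "{k. k \<ge> 1 \<and> concat (replicate k u) = w} = {}"
    by auto
  then show ?thesis
    unfolding subst_monomial_def if_not_P[OF False] by (simp only: sum.empty)
qed

text \<open>\<open>3 - x\<close> exchanges the letters 1 and 2.\<close>

lemma alternating_word:
  assumes "distinct_adj v" "set v \<subseteq> {1, 2 :: nat}" "even (length v)" "v \<noteq> []"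
  shows "\<exists>m\<ge>1. v = concat (replicate m [hd v, 3 - hd v])"
  using assms
proof (induction v rule: induct_list012)
  case (3 x y v)
  have y: "y = 3 - x"
    using 3 by auto
  show ?case
  proof (cases "v = []")
    case True
    then show ?thesis
      using y by (intro exI[of _ 1]) simp
  next
    case False
    then have "hd v = x"
      using 3(3,4) by (cases v) auto
    moreover obtain m where "m \<ge> 1" "v = concat (replicate m [hd v, 3 - hd v])"
      using 3 False by (auto simp: distinct_adj_Cons)
    ultimately show ?thesis
      using y by (intro exI[of _ "Suc m"]) simp
  qed
qed auto

theorem theorem2p7:
  fixes scale :: "complex \<Rightarrow> 'a::{ring, monoid_mult} \<Rightarrow> 'a"
    and B :: "'a set" and \<phi> :: "'a \<Rightarrow> 'a" and a a' :: 'a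
  assumes "nc_prob_space scale B \<phi>"
    and "B_trace \<phi>"
    and "B_even B \<phi> a"
    and "B_even B \<phi> a'"
    and "free_over scale B \<phi> a a'"
  shows "R_diagonal scale B \<phi> (a * a') (a' * a)"
proof -
  interpret nc_prob_space scale B \<phi> by fact
  define c where "c = (\<lambda>i. if i then a else a')"
  interpret free_even_pair scale B \<phi> c
  proof
    show "B_even B \<phi> (c i)" for i
      using assms(3,4) by (simp add: c_def)
    show "free_amalgamated \<phi> UNIV (\<lambda>i. unital_subalgebra scale hull (B \<union> {c i}))"
      unfolding free_amalgamated_def
    proof (intro allI impI)
      fix w :: "(bool \<times> 'a) list"
      let ?e = "\<lambda>i. if i then 1 else 2 :: nat"
      let ?w = "map (\<lambda>(i, x). (?e i, x)) w"
      assume w: "w \<noteq> []" "distinct_adj (map fst w)"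
        "\<forall>(i, x)\<in>set w. i \<in> UNIV \<and> x \<in> unital_subalgebra scale hull (B \<union> {c i}) \<and> \<phi> x = 0"
      have snd: "map snd ?w = map snd w" and "map fst ?w = map ?e (map fst w)"
        by (auto simp: case_prod_beta)
      moreover have "distinct_adj (map ?e (map fst w))"
        using w(2) by (rule distinct_adj_mapI) (auto simp: inj_on_def)
      ultimately have "distinct_adj (map fst ?w)"
        by (simp only:)
      moreover have "\<forall>(i, x)\<in>set ?w. i \<in> {1, 2} \<and>
          x \<in> unital_subalgebra scale hull (B \<union> {if i = 1 then a else a'}) \<and> \<phi> x = 0"
        using w(3) by (fastforce simp: c_def split: if_splits)
      moreover have "?w \<noteq> []"
        using w(1) by simp
      ultimately have "\<phi> (prod_list (map snd ?w)) = 0"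
        using assms(5) unfolding free_over_def free_amalgamated_def by blast
      then show "\<phi> (prod_list (map snd w)) = 0"
        unfolding snd .
    qed
  qed
  show ?thesis
    unfolding R_diagonal_def
  proof
    fix \<beta> :: "nat list \<Rightarrow> nat \<Rightarrow> 'a" assume \<beta>: "\<beta> \<in> insertions B 2"
    define R where "R = R_transform scale \<phi> \<beta> [a * a', a' * a]"
    \<comment> \<open>Candidates for both series at once: \<open>u = [1, 2]\<close> gives the one in
      the product of the indeterminates in this order, \<open>u = [2, 1]\<close> the one in the
      reverse order.\<close>
    define f where "f u = (\<lambda>v. if v \<in> words 1 then R (concat (replicate (length v) u)) else 0)" for u
    have "R v \<in> B" for v
      by (simp add: R_def R_transform_def cumulant_in_B)
    then have f: "f u \<in> Theta B 1" for u
      by (simp add: f_def Theta_def)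
    have R_0: "R v = 0" if v: "\<nexists>m. m \<ge> 1 \<and> v = concat (replicate m [1, 2])" "\<nexists>m. m \<ge> 1 \<and> v = concat (replicate m [2, 1])" for v
    proof (cases "v \<in> words 2")
      case True
      \<comment> \<open>Index 1 stands for \<open>c True * c False\<close> and index 2 for
        \<open>c False * c True\<close>. Positions in \<open>v\<close> start at 0, arguments of the
        cumulant at 1.\<close>
      define w where "w = (\<lambda>j. v ! (j - 1) = 1)"
      have set: "set v \<subseteq> {1, 2}" "v \<noteq> []"
        using True by (auto simp: words_def)
      have nth: "v ! (j - 1) \<in> {1, 2}" if "j \<in> {1..length v}" for j
        using set(1) nth_mem[of "j - 1" v] that by fastforce
      have "\<not> (alternating w {1..length v} \<and> even (length v))"
      proof
        assume alt: "alternating w {1..length v} \<and> even (length v)"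
        have "v ! i \<noteq> v ! Suc i" if "Suc i < length v" for i
        proof -
          have "adjacent {1..length v} (Suc i) (Suc (Suc i))"
            using that by (auto simp: adjacent_def)
          then have "w (Suc i) \<noteq> w (Suc (Suc i))"
            using alt unfolding alternating_def by blast
          then show ?thesis
            by (auto simp: w_def)
        qed
        then have "distinct_adj v"
          by (simp add: distinct_adj_conv_nth)
        then obtain m where "m \<ge> 1" "v = concat (replicate m [hd v, 3 - hd v])"
          using alternating_word set alt by blast
        moreover have "hd v = 1 \<or> hd v = 2"
          using set(1) hd_in_set[OF set(2)] by blast
        ultimately show False
          using v by auto
      qed
      moreover have "(let x = [a * a', a' * a] ! (v ! (j - 1) - 1) in if j = 1 then x else \<beta> v j * x) \<in> letter (w j)"
        if "j \<in> {1..length v}" for j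
      proof -
        have "[a * a', a' * a] ! (v ! (j - 1) - 1) = 1 * c (w j) * c (\<not> w j) * 1"
          using nth[OF that] by (auto simp: w_def c_def)
        then have "[a * a', a' * a] ! (v ! (j - 1) - 1) \<in> letter (w j)"
          unfolding letter_def by (metis (mono_tags, lifting) B_1 mem_Collect_eq)
        moreover have "j \<noteq> 1 \<Longrightarrow> \<beta> v j \<in> B"
          using \<beta> True that by (auto simp: insertions_def)
        ultimately show ?thesis
          by (auto simp: Let_def intro: letter_B_mult)
      qed
      moreover have "length v \<ge> 1"
        using set(2) by (cases v) auto
      ultimately have "cumulant scale \<phi> (length v)
          (\<lambda>j. let x = [a * a', a' * a] ! (v ! (j - 1) - 1) in if j = 1 then x else \<beta> v j * x) = 0"
        by (intro cumulant_eq_0) blast+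
      then show ?thesis
        by (simp add: R_def R_transform_def)
    qed (simp add: R_def R_transform_def numeral_2_eq_2)
    \<comment> \<open>No word is a power of both monomials, so at most one of the two substituted
      series contributes at any word.\<close>
    have disjoint: "concat (replicate m [1, 2]) \<noteq> concat (replicate k [2, 1 :: nat])" if "m \<ge> 1" for m k
      using that by (cases m; cases k) auto
    have "R v = subst_monomial (f [1, 2]) [1, 2] v + subst_monomial (f [2, 1]) [2, 1] v" for v
      using R_0[of v] disjoint unfolding f_def by (subst (1 2) subst_monomial_extract) auto
    then show "\<exists>f\<in>Theta B 1. \<exists>g\<in>Theta B 1. R_transform scale \<phi> \<beta> [a * a', a' * a] =
        (\<lambda>w. subst_monomial f [1, 2] w + subst_monomial g [2, 1] w)"
      using f unfolding R_def[symmetric] by (intro bexI[of _ "f [1, 2]"] bexI[of _ "f [2, 1]"]) auto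
  qed
qed

end
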